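(* Let $\mathrm G$ be a quasi-split connected reductive group over a non-Archimedean local field $F$ of characteristic zero and $G=\mathrm G(F)$. Suppose that there is a theory of local Arthur packets for $G$ as conjectured by Arthur. Assume that the following hold for $G$: (a) (Closure Ordering Conjecture) for every local Arthur parameter $\psi$ of $G$ and every $\pi\in\Pi_\psi$, one has $\phi_\pi\geq_C\phi_\psi$; (b) for every local Arthur parameter $\psi$ of $G$, $\Pi_{\widehat\psi}=\{\widehat\pi\mid\pi\in\Pi_\psi\}$; (c) if $\pi$ is an irreducible generic representation of $G$ of Arthur type, then $\widehat\pi\in\Pi_{\phi_0}$, where $\phi_0$ is the local $L$-parameter corresponding to the zero orbit in the Vogan variety $V_\lambda$ with $\lambda=\lambda_{\phi_\pi}$. If $\psi\in\Psi(G)$ and $\Pi_\psi$ contains a generic representation, then $\psi$ is tempered.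
   Context: **Setting.** The local Langlands correspondence for $G$ is assumed: each irreducible admissible $\pi$ has an $L$-parameter $\phi_\pi:W_F\times\mathrm{SL}_2(\mathbb C)\to{}^LG$, and $\Pi_\phi$ is the $L$-packet of $\phi$. $\Psi(G)$ is the set (up to $\widehat{\mathrm G}(\mathbb C)$-conjugacy) of continuous homomorphisms $\psi:W_F\times\mathrm{SL}_2^D(\mathbb C)\times\mathrm{SL}_2^A(\mathbb C)\to{}^LG$ ("local Arthur parameters") whose restriction to $W_F\times\mathrm{SL}_2^D(\mathbb C)$ is a tempered $L$-parameter and whose restriction to $\mathrm{SL}_2^A(\mathbb C)$ is analytic. $\psi$ is tempered if $\psi|_{\mathrm{SL}_2^A(\mathbb C)}$ is trivial. A theory of local Arthur packets (Arthur, *Unipotent automorphic representations: conjectures*, Conjecture 6.1) attaches to each $\psi\in\Psi(G)$ a finite multi-set $\Pi_\psi$ of irreducible representations of $G$, with in particular $\Pi_{\phi_\psi}\subseteq\Pi_\psi$, where $\phi_\psi(w,x)=\psi(w,x,\mathrm{diag}(|w|^{1/2},|w|^{-1/2}))$; the map $\psi\mapsto\phi_\psi$ is assumed injective. $\pi$ is of Arthur type if it belongs to some $\Pi_\psi$. $\widehat\psi(w,x,y)=\psi(w,y,x)$. $\widehat\pi$ is the Aubert–Zelevinsky dual: the irreducible representation $\pm\sum_P(-1)^{\dim A_P}[\mathrm{Ind}_P^G(\mathrm{Jac}_P(\pi))]$ (sum over standard parabolics $P$, $A_P$ the maximal split torus of the center of the Levi). **Closure ordering.** For an $L$-parameter $\phi$,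 $\lambda_\phi(w)=\phi(w,\mathrm{diag}(|w|^{1/2},|w|^{-1/2}))$ is its infinitesimal character. For an infinitesimal character $\lambda:W_F\to{}^LG$ let $K_\lambda$, resp. $H_\lambda$, be the subgroup of $\widehat{\mathrm G}(\mathbb C)$ commuting with $\lambda(I_F)$, resp. $\lambda(W_F)$ ($I_F$ the inertia group), and let the Vogan variety be $V_\lambda=\{x\in\mathrm{Lie}(K_\lambda)\mid\mathrm{Ad}(\lambda(w))x=|w|x\ \forall w\in W_F\}$. The $L$-parameters $\phi$ with $\lambda_\phi=\lambda$ are in bijection with the (finitely many) $H_\lambda$-orbits in $V_\lambda$ by $\phi\mapsto C_\phi$, the orbit of $d(\phi|_{\mathrm{SL}_2(\mathbb C)})\begin{pmatrix}0&1\\0&0\end{pmatrix}$. $\phi_1\geq_C\phi_2$ means $\lambda_{\phi_1}=\lambda_{\phi_2}$ and $\overline{C_{\phi_1}}\supseteq C_{\phi_2}$. *)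

theory Defs
  imports
    "HOL-Analysis.Analysis"
    "HOL-Library.Poly_Mapping"
    "HOL-Library.Multiset"
    "HOL-Algebra.Module"
    "HOL-Algebra.Solvable_Groups"
    "HOL-Algebra.Algebraic_Closure_Type"
begin

section \<open>Linear algebraic groups\<close>

text \<open>
  An affine algebraic group is presented by a Zariski closed subgroup of \<open>GL_n\<close> over an
  algebraically closed field \<open>'k\<close>; \<open>n\<close> is the cardinality of the finite index type \<open>'n\<close>.
  Groups over a subfield \<open>k\<close> of \<open>'k\<close> are those cut out by polynomials over \<open>k\<close>
  (in characteristic zero, ``closed over \<open>k\<close>'' and ``defined over \<open>k\<close>'' agree).
\<close>

definition GL :: "('k::field ^ 'n ^ 'n) monoid" where
  "GL = \<lparr>carrier = {g. invertible g}, mult = (**), one = mat 1\<rparr>"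

abbreviation grp :: "('k::field ^ 'n ^ 'n) set \<Rightarrow> ('k ^ 'n ^ 'n) monoid" where
  "grp G \<equiv> GL\<lparr>carrier := G\<rparr>"

definition SL2 :: "('k::field ^ 2 ^ 2) set" where
  "SL2 = {x. det x = 1}"

definition mat2 :: "'k::field \<Rightarrow> 'k \<Rightarrow> 'k \<Rightarrow> 'k \<Rightarrow> 'k ^ 2 ^ 2" where
  "mat2 a b c d = vector [vector [a, b], vector [c, d]]"

definition conj_mat :: "'k::field ^ 'n ^ 'n \<Rightarrow> 'k ^ 'n ^ 'n \<Rightarrow> 'k ^ 'n ^ 'n" where
  "conj_mat g x = g ** x ** matrix_inv g"

type_synonym ('x, 'k) mpoly = "('x \<Rightarrow>\<^sub>0 nat) \<Rightarrow>\<^sub>0 'k"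

text \<open>Evaluation at \<open>a\<close> after applying \<open>h\<close> to the coefficients.\<close>

definition mpoly_eval ::
    "('k::comm_ring_1 \<Rightarrow> 'r::comm_ring_1) \<Rightarrow> ('x \<Rightarrow> 'r) \<Rightarrow> ('x, 'k) mpoly \<Rightarrow> 'r" where
  "mpoly_eval h a p =
    (\<Sum>m\<in>Poly_Mapping.keys p. h (Poly_Mapping.lookup p m) *
      (\<Prod>x\<in>Poly_Mapping.keys m. a x ^ Poly_Mapping.lookup m x))"

definition eval_at :: "'k::field ^ 'n ^ 'n \<Rightarrow> ('n \<times> 'n, 'k) mpoly \<Rightarrow> 'k" where
  "eval_at g p = mpoly_eval (\<lambda>c. c) (\<lambda>(i, j). g $ i $ j) p"

definition zariski_closed :: "'k::field set \<Rightarrow> ('k ^ 'n ^ 'n) set \<Rightarrow> bool" where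
  "zariski_closed k S \<longleftrightarrow>
    (\<exists>I. (\<forall>p\<in>I. \<forall>m. Poly_Mapping.lookup p m \<in> k) \<and>
         S = {g \<in> carrier GL. \<forall>p\<in>I. eval_at g p = 0})"

definition zariski_connected :: "('k::field ^ 'n ^ 'n) set \<Rightarrow> bool" where
  "zariski_connected S \<longleftrightarrow>
    S \<noteq> {} \<and>
    \<not> (\<exists>A B. zariski_closed UNIV A \<and> zariski_closed UNIV B \<and>
            A \<noteq> {} \<and> B \<noteq> {} \<and> A \<inter> B = {} \<and> A \<union> B = S)"

definition zariski_irreducible :: "('k::field ^ 'n ^ 'n) set \<Rightarrow> bool" where
  "zariski_irreducible S \<longleftrightarrow>
    zariski_closed UNIV S \<and> S \<noteq> {} \<and>
    (\<forall>A B. zariski_closed UNIV A \<and> zariski_closed UNIV B \<and> A \<union> B = S \<longrightarrow> A = S \<or> B = S)"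

definition zariski_dim :: "('k::field ^ 'n ^ 'n) set \<Rightarrow> nat" where
  "zariski_dim S =
    (GREATEST d. \<exists>Z :: nat \<Rightarrow> _. (\<forall>i\<le>d. zariski_irreducible (Z i) \<and> Z i \<subseteq> S) \<and>
                              (\<forall>i<d. Z i \<subset> Z (Suc i)))"

definition linear_group :: "'k::field set \<Rightarrow> ('k ^ 'n ^ 'n) set \<Rightarrow> bool" where
  "linear_group k G \<longleftrightarrow> subgroup G GL \<and> zariski_closed k G"

text \<open>The powers of \<open>u - 1\<close> are written by iteration, since \<open>^\<close> on vectors is componentwise.\<close>

definition unipotent :: "'k::field ^ 'n ^ 'n \<Rightarrow> bool" where
  "unipotent u \<longleftrightarrow> (\<exists>r. (((**) (u - mat 1)) ^^ r) (mat 1) = 0)"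

definition diagonal :: "'k::field ^ 'n ^ 'n \<Rightarrow> bool" where
  "diagonal x \<longleftrightarrow> (\<forall>i j. i \<noteq> j \<longrightarrow> x $ i $ j = 0)"

text \<open>The union is itself a group of the same kind, hence the largest one.\<close>

definition unipotent_radical :: "('k::field ^ 'n ^ 'n) set \<Rightarrow> ('k ^ 'n ^ 'n) set" where
  "unipotent_radical G =
    \<Union>{U. linear_group UNIV U \<and> zariski_connected U \<and> U \<lhd> grp G \<and> (\<forall>u\<in>U. unipotent u)}"

definition connected_reductive :: "'k::field set \<Rightarrow> ('k ^ 'n ^ 'n) set \<Rightarrow> bool" where
  "connected_reductive k G \<longleftrightarrow>
    linear_group k G \<and> zariski_connected G \<and> unipotent_radical G = {mat 1}"

definition borel_subgroup :: "('k::field ^ 'n ^ 'n) set \<Rightarrow> ('k ^ 'n ^ 'n) set \<Rightarrow> bool" where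
  "borel_subgroup G B \<longleftrightarrow>
    (let solv = (\<lambda>H. linear_group UNIV H \<and> zariski_connected H \<and> solvable (grp H) \<and> H \<subseteq> G)
     in solv B \<and> (\<forall>H. solv H \<and> B \<subseteq> H \<longrightarrow> H = B))"

definition rational_borel ::
    "'k::field set \<Rightarrow> ('k ^ 'n ^ 'n) set \<Rightarrow> ('k ^ 'n ^ 'n) set \<Rightarrow> bool" where
  "rational_borel k G B \<longleftrightarrow> borel_subgroup G B \<and> zariski_closed k B"

definition quasi_split :: "'k::field set \<Rightarrow> ('k ^ 'n ^ 'n) set \<Rightarrow> bool" where
  "quasi_split k G \<longleftrightarrow> (\<exists>B. rational_borel k G B)"

definition parabolic ::
    "'k::field set \<Rightarrow> ('k ^ 'n ^ 'n) set \<Rightarrow> ('k ^ 'n ^ 'n) set \<Rightarrow> bool" where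
  "parabolic k G P \<longleftrightarrow> linear_group k P \<and> P \<subseteq> G \<and> (\<exists>B. borel_subgroup G B \<and> B \<subseteq> P)"

definition levi_subgroup ::
    "'k::field set \<Rightarrow> ('k ^ 'n ^ 'n) set \<Rightarrow> ('k ^ 'n ^ 'n) set \<Rightarrow> bool" where
  "levi_subgroup k P M \<longleftrightarrow>
    linear_group k M \<and> M \<subseteq> P \<and> M \<inter> unipotent_radical P = {mat 1} \<and>
    P = {m ** u | m u. m \<in> M \<and> u \<in> unipotent_radical P}"

definition center :: "('k::field ^ 'n ^ 'n) set \<Rightarrow> ('k ^ 'n ^ 'n) set" where
  "center M = {z \<in> M. \<forall>m\<in>M. z ** m = m ** z}"

text \<open>A torus is split over \<open>k\<close> iff the ambient representation is diagonalizable over \<open>k\<close>.\<close>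

definition split_torus :: "'k::field set \<Rightarrow> ('k ^ 'n ^ 'n) set \<Rightarrow> bool" where
  "split_torus k A \<longleftrightarrow>
    linear_group k A \<and> zariski_connected A \<and>
    (\<exists>p. invertible p \<and> (\<forall>i j. p $ i $ j \<in> k) \<and> (\<forall>a\<in>A. diagonal (conj_mat p a)))"

definition maximal_torus :: "('k::field ^ 'n ^ 'n) set \<Rightarrow> ('k ^ 'n ^ 'n) set \<Rightarrow> bool" where
  "maximal_torus G T \<longleftrightarrow>
    split_torus UNIV T \<and> T \<subseteq> G \<and> (\<forall>T'. split_torus UNIV T' \<and> T \<subseteq> T' \<and> T' \<subseteq> G \<longrightarrow> T' = T)"

definition max_split_torus ::
    "'k::field set \<Rightarrow> ('k ^ 'n ^ 'n) set \<Rightarrow> ('k ^ 'n ^ 'n) set \<Rightarrow> bool" where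
  "max_split_torus k Z A \<longleftrightarrow>
    split_torus k A \<and> A \<subseteq> Z \<and> (\<forall>A'. split_torus k A' \<and> A \<subseteq> A' \<and> A' \<subseteq> Z \<longrightarrow> A' = A)"

text \<open>\<open>dim A_P\<close>; it does not depend on the Levi factor \<open>M\<close>, all of which are conjugate.\<close>

definition dim_A :: "'k::field set \<Rightarrow> ('k ^ 'n ^ 'n) set \<Rightarrow> nat" where
  "dim_A k P =
    (THE d. \<exists>M A. levi_subgroup k P M \<and> max_split_torus k (center M) A \<and> zariski_dim A = d)"

text \<open>Tangent space at the identity: \<open>p (1 + \<epsilon>\<xi>)\<close> has no linear term, for all \<open>p\<close> vanishing on \<open>G\<close>.\<close>

definition lie :: "('k::field ^ 'n ^ 'n) set \<Rightarrow> ('k ^ 'n ^ 'n) set" where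
  "lie G = {\<xi>. \<forall>p. (\<forall>g\<in>G. eval_at g p = 0) \<longrightarrow>
     poly.coeff
       (mpoly_eval (\<lambda>c. pCons c 0)
         (\<lambda>(i, j). pCons ((mat 1 :: 'k ^ 'n ^ 'n) $ i $ j) (pCons (\<xi> $ i $ j) 0)) p) 1 = 0}"

definition regular_on :: "('k::field ^ 'n ^ 'n) set \<Rightarrow> ('k ^ 'n ^ 'n \<Rightarrow> 'k) \<Rightarrow> bool" where
  "regular_on G f \<longleftrightarrow> (\<exists>p N. \<forall>g\<in>G. f g * det g ^ N = eval_at g p)"

definition alg_hom ::
    "('k::field ^ 'n ^ 'n) set \<Rightarrow> ('k ^ 'm ^ 'm) set \<Rightarrow> ('k ^ 'n ^ 'n \<Rightarrow> 'k ^ 'm ^ 'm) \<Rightarrow> bool" where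
  "alg_hom G H f \<longleftrightarrow> f \<in> hom (grp G) (grp H) \<and> (\<forall>i j. regular_on G (\<lambda>g. f g $ i $ j))"


section \<open>Root data\<close>

definition character_group :: "('k::field ^ 'n ^ 'n) set \<Rightarrow> ('k ^ 'n ^ 'n \<Rightarrow> 'k) monoid" where
  "character_group T =
    \<lparr>carrier = {\<eta> \<in> extensional T. regular_on T \<eta> \<and> (\<forall>t\<in>T. \<eta> t \<noteq> 0) \<and>
                 (\<forall>s\<in>T. \<forall>t\<in>T. \<eta> (s ** t) = \<eta> s * \<eta> t)},
     mult = (\<lambda>\<eta> \<eta>'. restrict (\<lambda>t. \<eta> t * \<eta>' t) T),
     one = restrict (\<lambda>t. 1) T\<rparr>"

definition cocharacter_group :: "('k::field ^ 'n ^ 'n) set \<Rightarrow> ('k \<Rightarrow> 'k ^ 'n ^ 'n) monoid" where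
  "cocharacter_group T =
    \<lparr>carrier = {\<mu> \<in> extensional (- {0}). (\<forall>z. z \<noteq> 0 \<longrightarrow> \<mu> z \<in> T) \<and>
                 (\<forall>y z. y \<noteq> 0 \<and> z \<noteq> 0 \<longrightarrow> \<mu> (y * z) = \<mu> y ** \<mu> z) \<and>
                 (\<forall>i j. \<exists>p N. \<forall>z. z \<noteq> 0 \<longrightarrow> \<mu> z $ i $ j * z ^ N = poly p z)},
     mult = (\<lambda>\<mu> \<mu>'. restrict (\<lambda>z. \<mu> z ** \<mu>' z) (- {0})),
     one = restrict (\<lambda>z. mat 1) (- {0})\<rparr>"

definition pairing :: "('k::field ^ 'n ^ 'n \<Rightarrow> 'k) \<Rightarrow> ('k \<Rightarrow> 'k ^ 'n ^ 'n) \<Rightarrow> int" where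
  "pairing \<eta> \<mu> = (THE n. \<forall>z. z \<noteq> 0 \<longrightarrow> \<eta> (\<mu> z) = z powi n)"

definition root_space ::
    "('k::field ^ 'n ^ 'n) set \<Rightarrow> ('k ^ 'n ^ 'n) set \<Rightarrow> ('k ^ 'n ^ 'n \<Rightarrow> 'k) \<Rightarrow> ('k ^ 'n ^ 'n) set"
  where "root_space G T \<eta> = {\<xi> \<in> lie G. \<forall>t\<in>T. conj_mat t \<xi> = mat (\<eta> t) ** \<xi>}"

text \<open>For a Borel subgroup \<open>B\<close> containing \<open>T\<close>, \<open>roots B T\<close> are the positive roots.\<close>

definition roots ::
    "('k::field ^ 'n ^ 'n) set \<Rightarrow> ('k ^ 'n ^ 'n) set \<Rightarrow> ('k ^ 'n ^ 'n \<Rightarrow> 'k) set" where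
  "roots G T = {\<alpha> \<in> carrier (character_group T).
     (\<exists>t\<in>T. \<alpha> t \<noteq> 1) \<and> (\<exists>\<xi>\<in>root_space G T \<alpha>. \<xi> \<noteq> 0)}"

definition simple_roots ::
    "('k::field ^ 'n ^ 'n) set \<Rightarrow> ('k ^ 'n ^ 'n) set \<Rightarrow> ('k ^ 'n ^ 'n \<Rightarrow> 'k) set" where
  "simple_roots B T = {\<alpha> \<in> roots B T. \<not> (\<exists>\<beta>\<in>roots B T. \<exists>\<gamma>\<in>roots B T. \<forall>t\<in>T. \<alpha> t = \<beta> t * \<gamma> t)}"

text \<open>
  \<open>\<mu>\<close> is the coroot of \<open>\<alpha>\<close>: the restriction to the diagonal torus of a homomorphism from
  \<open>SL_2\<close> whose upper and lower unipotent parts have weights \<open>\<alpha>\<close> and \<open>-\<alpha>\<close>.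
\<close>

definition coroot ::
    "('k::field ^ 'n ^ 'n) set \<Rightarrow> ('k ^ 'n ^ 'n) set \<Rightarrow> ('k ^ 'n ^ 'n \<Rightarrow> 'k) \<Rightarrow>
     ('k \<Rightarrow> 'k ^ 'n ^ 'n) \<Rightarrow> bool" where
  "coroot G T \<alpha> \<mu> \<longleftrightarrow>
    \<mu> \<in> carrier (cocharacter_group T) \<and>
    (\<exists>h. alg_hom SL2 G h \<and> h (mat2 1 1 0 1) \<noteq> mat 1 \<and>
      (\<forall>t\<in>T. \<forall>x. conj_mat t (h (mat2 1 x 0 1)) = h (mat2 1 (\<alpha> t * x) 0 1) \<and>
                  conj_mat t (h (mat2 1 0 x 1)) = h (mat2 1 0 (inverse (\<alpha> t) * x) 1)) \<and>
      (\<forall>z. z \<noteq> 0 \<longrightarrow> h (mat2 z 0 0 (inverse z)) = \<mu> z))"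

text \<open>
  \<open>i : X\<^sup>*(T) \<rightarrow> X\<^sub>*(Td)\<close> and \<open>j : X\<^sub>*(T) \<rightarrow> X\<^sup>*(Td)\<close> identify the based root datum of
  \<open>(Gd, Bd, Td)\<close> with the dual of that of \<open>(G, B, T)\<close>.
\<close>

definition dual_root_data ::
    "('k::field ^ 'n ^ 'n) set \<Rightarrow> ('k ^ 'n ^ 'n) set \<Rightarrow> ('k ^ 'n ^ 'n) set \<Rightarrow>
     ('l::field ^ 'm ^ 'm) set \<Rightarrow> ('l ^ 'm ^ 'm) set \<Rightarrow> ('l ^ 'm ^ 'm) set \<Rightarrow>
     (('k ^ 'n ^ 'n \<Rightarrow> 'k) \<Rightarrow> 'l \<Rightarrow> 'l ^ 'm ^ 'm) \<Rightarrow>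
     (('k \<Rightarrow> 'k ^ 'n ^ 'n) \<Rightarrow> 'l ^ 'm ^ 'm \<Rightarrow> 'l) \<Rightarrow> bool" where
  "dual_root_data G B T Gd Bd Td i j \<longleftrightarrow>
    i \<in> iso (character_group T) (cocharacter_group Td) \<and>
    j \<in> iso (cocharacter_group T) (character_group Td) \<and>
    (\<forall>\<eta>\<in>carrier (character_group T). \<forall>\<mu>\<in>carrier (cocharacter_group T).
       pairing (j \<mu>) (i \<eta>) = pairing \<eta> \<mu>) \<and>
    (\<forall>\<alpha>\<in>roots B T. \<forall>\<mu>. coroot G T \<alpha> \<mu> \<longrightarrow>
       j \<mu> \<in> roots Bd Td \<and> coroot Gd Td (j \<mu>) (i \<alpha>)) \<and>
    (\<forall>\<beta>\<in>roots Bd Td. \<exists>\<alpha>\<in>roots B T. \<exists>\<mu>. coroot G T \<alpha> \<mu> \<and> j \<mu> = \<beta>)"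

text \<open>A pinning: one nonzero vector in each simple root space.\<close>

definition pinning ::
    "('k::field ^ 'n ^ 'n) set \<Rightarrow> ('k ^ 'n ^ 'n) set \<Rightarrow> ('k ^ 'n ^ 'n) set \<Rightarrow> bool" where
  "pinning B T E \<longleftrightarrow>
    E \<subseteq> (\<Union>\<alpha>\<in>simple_roots B T. root_space B T \<alpha>) \<and>
    (\<forall>\<alpha>\<in>simple_roots B T. \<exists>\<xi>. \<xi> \<noteq> 0 \<and> E \<inter> root_space B T \<alpha> = {\<xi>})"


section \<open>Local fields and Weil groups\<close>

text \<open>Characteristic zero is imposed by the type class of \<open>'f\<close>.\<close>

definition nonarch_local_field :: "('f::field_char_0 \<Rightarrow> real) \<Rightarrow> bool" where
  "nonarch_local_field v \<longleftrightarrow>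
    (\<forall>x. v x \<ge> 0) \<and> (\<forall>x. v x = 0 \<longleftrightarrow> x = 0) \<and>
    (\<forall>x y. v (x * y) = v x * v y) \<and> (\<forall>x y. v (x + y) \<le> max (v x) (v y)) \<and>
    (\<exists>\<pi>. \<pi> \<noteq> 0 \<and> v \<pi> < 1 \<and> (\<forall>x. v x < 1 \<longrightarrow> v x \<le> v \<pi>)) \<and>
    finite ((\<lambda>x. {y. v (y - x) < 1}) ` {x. v x \<le> 1}) \<and>
    (\<forall>s :: nat \<Rightarrow> 'f. (\<forall>e>0. \<exists>N. \<forall>m\<ge>N. \<forall>n\<ge>N. v (s m - s n) < e) \<longrightarrow>
       (\<exists>l. \<forall>e>0. \<exists>N. \<forall>n\<ge>N. v (s n - l) < e))"

definition residue_card :: "('f::field_char_0 \<Rightarrow> real) \<Rightarrow> nat" where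
  "residue_card v = card ((\<lambda>x. {y. v (y - x) < 1}) ` {x. v x \<le> 1})"

abbreviation base :: "'f::field_char_0 alg_closure set" where
  "base \<equiv> range to_ac"

type_synonym 'f gal = "'f alg_closure \<Rightarrow> 'f alg_closure"

definition galois_group :: "'f::field_char_0 gal set" where
  "galois_group = {\<sigma>. bij \<sigma> \<and> (\<forall>x y. \<sigma> (x + y) = \<sigma> x + \<sigma> y) \<and>
     (\<forall>x y. \<sigma> (x * y) = \<sigma> x * \<sigma> y) \<and> (\<forall>a. \<sigma> (to_ac a) = to_ac a)}"

definition integers_bar :: "('f::field_char_0 \<Rightarrow> real) \<Rightarrow> 'f alg_closure set" where
  "integers_bar v = {z. \<exists>p :: 'f poly. Polynomial.lead_coeff p = 1 \<and> (\<forall>i. v (poly.coeff p i) \<le> 1) \<and>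
     poly (map_poly to_ac p) z = 0}"

definition max_ideal_bar :: "('f::field_char_0 \<Rightarrow> real) \<Rightarrow> 'f alg_closure set" where
  "max_ideal_bar v = {z \<in> integers_bar v. z = 0 \<or> inverse z \<notin> integers_bar v}"

text \<open>\<open>\<sigma>\<close> acts on the residue field of the algebraic closure as \<open>z \<mapsto> z ^ (q ^ n)\<close>.\<close>

definition frobenius_power :: "('f::field_char_0 \<Rightarrow> real) \<Rightarrow> 'f gal \<Rightarrow> int \<Rightarrow> bool" where
  "frobenius_power v \<sigma> n \<longleftrightarrow>
    (\<forall>z\<in>integers_bar v.
       \<sigma> z ^ (residue_card v ^ nat (- n)) - z ^ (residue_card v ^ nat n) \<in> max_ideal_bar v)"

definition weil_group :: "('f::field_char_0 \<Rightarrow> real) \<Rightarrow> 'f gal set" where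
  "weil_group v = {\<sigma> \<in> galois_group. \<exists>n. frobenius_power v \<sigma> n}"

definition inertia_group :: "('f::field_char_0 \<Rightarrow> real) \<Rightarrow> 'f gal set" where
  "inertia_group v = {\<sigma> \<in> galois_group. frobenius_power v \<sigma> 0}"

definition weil_degree :: "('f::field_char_0 \<Rightarrow> real) \<Rightarrow> 'f gal \<Rightarrow> int" where
  "weil_degree v \<sigma> = (THE n. frobenius_power v \<sigma> n)"

text \<open>Normalised so that a geometric Frobenius element has norm \<open>1 / q\<close>.\<close>

definition weil_norm :: "('f::field_char_0 \<Rightarrow> real) \<Rightarrow> 'f gal \<Rightarrow> real" where
  "weil_norm v \<sigma> = real (residue_card v) powi weil_degree v \<sigma>"

text \<open>The topology in which the inertia group is open and carries the Krull topology.\<close>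

definition weil_topology :: "('f::field_char_0 \<Rightarrow> real) \<Rightarrow> 'f gal topology" where
  "weil_topology v = topology_generated_by
    {{\<tau> \<in> weil_group v. weil_degree v \<tau> = weil_degree v \<sigma> \<and> (\<forall>x\<in>S. \<tau> x = \<sigma> x)} | \<sigma> S.
       \<sigma> \<in> weil_group v \<and> finite S}"

definition Weil :: "('f::field_char_0 \<Rightarrow> real) \<Rightarrow> 'f gal monoid" where
  "Weil v = \<lparr>carrier = weil_group v, mult = (\<circ>), one = id\<rparr>"


section \<open>Smooth representations of \<open>G(F)\<close>\<close>

definition points :: "('f::field_char_0 alg_closure ^ 'n ^ 'n) set \<Rightarrow> ('f ^ 'n ^ 'n) set" where
  "points G = {g. map_matrix to_ac g \<in> G}"

definition near :: "('f::field_char_0 \<Rightarrow> real) \<Rightarrow> real \<Rightarrow> 'f ^ 'n ^ 'n \<Rightarrow> bool" where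
  "near v e g \<longleftrightarrow> (\<forall>i j. v (g $ i $ j - (mat 1 :: 'f ^ 'n ^ 'n) $ i $ j) < e)"

abbreviation complex_ring :: "complex ring" where
  "complex_ring \<equiv> ring_of_type_algebra"

text \<open>
  As usual for modules in the library, the fields \<open>mult\<close> and \<open>one\<close> carry no information.
\<close>

record ('g, 'v) rep = "(complex, 'v) module" + act :: "'g \<Rightarrow> 'v \<Rightarrow> 'v"

definition representation ::
    "('f::field_char_0 ^ 'n ^ 'n) set \<Rightarrow> ('f ^ 'n ^ 'n, 'v) rep \<Rightarrow> bool" where
  "representation H V \<longleftrightarrow>
    Module.module complex_ring V \<and>
    (\<forall>g\<in>H. \<forall>x\<in>carrier V. act V g x \<in> carrier V) \<and>
    (\<forall>g\<in>H. \<forall>x\<in>carrier V. \<forall>y\<in>carrier V. act V g (x \<oplus>\<^bsub>V\<^esub> y) = act V g x \<oplus>\<^bsub>V\<^esub> act V g y) \<and>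
    (\<forall>g\<in>H. \<forall>c. \<forall>x\<in>carrier V. act V g (c \<odot>\<^bsub>V\<^esub> x) = c \<odot>\<^bsub>V\<^esub> act V g x) \<and>
    (\<forall>x\<in>carrier V. act V (mat 1) x = x) \<and>
    (\<forall>g\<in>H. \<forall>h\<in>H. \<forall>x\<in>carrier V. act V (g ** h) x = act V g (act V h x))"

definition smooth ::
    "('f::field_char_0 \<Rightarrow> real) \<Rightarrow> ('f ^ 'n ^ 'n) set \<Rightarrow> ('f ^ 'n ^ 'n, 'v) rep \<Rightarrow> bool" where
  "smooth v H V \<longleftrightarrow> (\<forall>x\<in>carrier V. \<exists>e>0. \<forall>g\<in>H. near v e g \<longrightarrow> act V g x = x)"

definition span_in :: "('g, 'v) rep \<Rightarrow> 'v set \<Rightarrow> 'v set" where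
  "span_in V S = \<Inter>{W. submodule W complex_ring V \<and> S \<subseteq> W}"

definition admissible ::
    "('f::field_char_0 \<Rightarrow> real) \<Rightarrow> ('f ^ 'n ^ 'n) set \<Rightarrow> ('f ^ 'n ^ 'n, 'v) rep \<Rightarrow> bool" where
  "admissible v H V \<longleftrightarrow> smooth v H V \<and>
    (\<forall>K. subgroup K (grp H) \<and> (\<exists>e>0. \<forall>g\<in>H. near v e g \<longrightarrow> g \<in> K) \<longrightarrow>
       (\<exists>S. finite S \<and> S \<subseteq> carrier V \<and>
            {x \<in> carrier V. \<forall>g\<in>K. act V g x = x} \<subseteq> span_in V S))"

definition subrep ::
    "('f::field_char_0 ^ 'n ^ 'n) set \<Rightarrow> ('f ^ 'n ^ 'n, 'v) rep \<Rightarrow> 'v set \<Rightarrow> bool" where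
  "subrep H V W \<longleftrightarrow> submodule W complex_ring V \<and> (\<forall>g\<in>H. \<forall>x\<in>W. act V g x \<in> W)"

definition irreducible_rep ::
    "('f::field_char_0 ^ 'n ^ 'n) set \<Rightarrow> ('f ^ 'n ^ 'n, 'v) rep \<Rightarrow> bool" where
  "irreducible_rep H V \<longleftrightarrow> carrier V \<noteq> {\<zero>\<^bsub>V\<^esub>} \<and>
    (\<forall>W. subrep H V W \<longrightarrow> W = {\<zero>\<^bsub>V\<^esub>} \<or> W = carrier V)"

text \<open>The subquotient \<open>W' / W\<close> of \<open>V\<close> is isomorphic to \<open>S\<close>.\<close>

definition subquotient_iso ::
    "('f::field_char_0 ^ 'n ^ 'n) set \<Rightarrow> ('f ^ 'n ^ 'n, 'v) rep \<Rightarrow> 'v set \<Rightarrow> 'v set \<Rightarrow>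
     ('f ^ 'n ^ 'n, 'w) rep \<Rightarrow> bool" where
  "subquotient_iso H V W' W S \<longleftrightarrow>
    (\<exists>f. f ` W' = carrier S \<and> {x \<in> W'. f x = \<zero>\<^bsub>S\<^esub>} = W \<and>
      (\<forall>x\<in>W'. \<forall>y\<in>W'. f (x \<oplus>\<^bsub>V\<^esub> y) = f x \<oplus>\<^bsub>S\<^esub> f y) \<and>
      (\<forall>c. \<forall>x\<in>W'. f (c \<odot>\<^bsub>V\<^esub> x) = c \<odot>\<^bsub>S\<^esub> f x) \<and>
      (\<forall>g\<in>H. \<forall>x\<in>W'. f (act V g x) = act S g (f x)))"

definition rep_iso ::
    "('f::field_char_0 ^ 'n ^ 'n) set \<Rightarrow> ('f ^ 'n ^ 'n, 'v) rep \<Rightarrow> ('f ^ 'n ^ 'n, 'w) rep \<Rightarrow> bool" where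
  "rep_iso H V S \<longleftrightarrow> subquotient_iso H V (carrier V) {\<zero>\<^bsub>V\<^esub>} S"

text \<open>
  Irreducible smooth representations of \<open>G(F)\<close> have countable dimension, so all of them are
  realised, up to isomorphism, on subsets of one type of the cardinality of the continuum
  (with arbitrary module operations).
\<close>

type_synonym ('f, 'n) irrep = "('f ^ 'n ^ 'n, nat \<Rightarrow> complex) rep"

definition irreps ::
    "('f::field_char_0 \<Rightarrow> real) \<Rightarrow> ('f ^ 'n ^ 'n) set \<Rightarrow> ('f, 'n) irrep set" where
  "irreps v H = {V. representation H V \<and> admissible v H V \<and> irreducible_rep H V}"

definition Irr :: "('f::field_char_0 \<Rightarrow> real) \<Rightarrow> ('f ^ 'n ^ 'n) set \<Rightarrow> ('f, 'n) irrep set set" where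
  "Irr v H = irreps v H // {(V, V'). V \<in> irreps v H \<and> V' \<in> irreps v H \<and> rep_iso H V V'}"

text \<open>Multiplicity of an irreducible \<open>S\<close> as a composition factor of \<open>V\<close> of finite length.\<close>

definition composition_series ::
    "('f::field_char_0 ^ 'n ^ 'n) set \<Rightarrow> ('f ^ 'n ^ 'n, 'v) rep \<Rightarrow> 'v set list \<Rightarrow> bool" where
  "composition_series H V ws \<longleftrightarrow>
    ws \<noteq> [] \<and> hd ws = {\<zero>\<^bsub>V\<^esub>} \<and> last ws = carrier V \<and> (\<forall>W\<in>set ws. subrep H V W) \<and>
    (\<forall>i. Suc i < length ws \<longrightarrow> ws ! i \<subset> ws ! Suc i \<and>
       (\<forall>W. subrep H V W \<and> ws ! i \<subseteq> W \<and> W \<subseteq> ws ! Suc i \<longrightarrow> W = ws ! i \<or> W = ws ! Suc i))"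

definition multiplicity_of ::
    "('f::field_char_0 ^ 'n ^ 'n) set \<Rightarrow> ('f ^ 'n ^ 'n, 'w) rep \<Rightarrow> ('f ^ 'n ^ 'n, 'v) rep \<Rightarrow> nat" where
  "multiplicity_of H S V =
    (THE m. \<exists>ws. composition_series H V ws \<and>
       m = card {i. Suc i < length ws \<and> subquotient_iso H V (ws ! Suc i) (ws ! i) S})"

text \<open>
  The Jacquet module \<open>V / V(N)\<close>, viewed as a representation of \<open>P(F)\<close> trivial on \<open>N(F)\<close>, and
  smooth induction from \<open>P(F)\<close> to \<open>G(F)\<close>. Both are unnormalised: in \<open>Ind \<circ> Jac\<close> the factors
  \<open>\<delta>\<^bsub>P\<^esub>\<^bsup>1/2\<^esup>\<close> and \<open>\<delta>\<^bsub>P\<^esub>\<^bsup>-1/2\<^esup>\<close> cancel.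
\<close>

definition jacquet_kernel ::
    "('f::field_char_0 alg_closure ^ 'n ^ 'n) set \<Rightarrow> ('f ^ 'n ^ 'n, 'v) rep \<Rightarrow> 'v set" where
  "jacquet_kernel P V =
    span_in V {act V u x \<ominus>\<^bsub>V\<^esub> x | u x. u \<in> points (unipotent_radical P) \<and> x \<in> carrier V}"

definition jacquet ::
    "('f::field_char_0 alg_closure ^ 'n ^ 'n) set \<Rightarrow> ('f ^ 'n ^ 'n, 'v) rep \<Rightarrow>
     ('f ^ 'n ^ 'n, 'v set) rep" where
  "jacquet P V = (let W = jacquet_kernel P V in
    \<lparr>carrier = A_RCOSETS V W,
     mult = undefined, one = undefined,
     zero = W, add = set_add V,
     smult = (\<lambda>c \<xi>. {c \<odot>\<^bsub>V\<^esub> x \<oplus>\<^bsub>V\<^esub> y | x y. x \<in> \<xi> \<and> y \<in> W}),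
     act = (\<lambda>p \<xi>. act V p ` \<xi>)\<rparr>)"

definition induced ::
    "('f::field_char_0 \<Rightarrow> real) \<Rightarrow> ('f ^ 'n ^ 'n) set \<Rightarrow> ('f ^ 'n ^ 'n) set \<Rightarrow>
     ('f ^ 'n ^ 'n, 'v) rep \<Rightarrow> ('f ^ 'n ^ 'n, 'f ^ 'n ^ 'n \<Rightarrow> 'v) rep" where
  "induced v H P W =
    \<lparr>carrier = {f \<in> H \<rightarrow>\<^sub>E carrier W.
                 (\<forall>p\<in>P. \<forall>g\<in>H. f (p ** g) = act W p (f g)) \<and>
                 (\<exists>e>0. \<forall>k\<in>H. near v e k \<longrightarrow> (\<forall>g\<in>H. f (g ** k) = f g))},
     mult = undefined, one = undefined,
     zero = restrict (\<lambda>g. \<zero>\<^bsub>W\<^esub>) H,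
     add = (\<lambda>f f'. restrict (\<lambda>g. f g \<oplus>\<^bsub>W\<^esub> f' g) H),
     smult = (\<lambda>c f. restrict (\<lambda>g. c \<odot>\<^bsub>W\<^esub> f g) H),
     act = (\<lambda>h f. restrict (\<lambda>g. f (g ** h)) H)\<rparr>"

text \<open>
  The identity \<open>\<plusminus> [V'] = \<Sum>\<^sub>P (-1)\<^bsup>dim A\<^sub>P\<^esup> [Ind\<^sub>P (Jac\<^sub>P V)]\<close> in the Grothendieck group, tested on
  the multiplicity of every irreducible; \<open>P\<close> runs over the parabolic subgroups containing \<open>B\<close>.
\<close>

definition is_aubert_dual ::
    "('f::field_char_0 \<Rightarrow> real) \<Rightarrow> ('f alg_closure ^ 'n ^ 'n) set \<Rightarrow> ('f alg_closure ^ 'n ^ 'n) set \<Rightarrow>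
     ('f, 'n) irrep \<Rightarrow> ('f, 'n) irrep \<Rightarrow> bool" where
  "is_aubert_dual v G B V V' \<longleftrightarrow>
    (\<exists>\<epsilon>\<in>{1, -1 :: int}. \<forall>S\<in>irreps v (points G).
       (\<Sum>P | parabolic base G P \<and> B \<subseteq> P.
          (- 1) ^ dim_A base P *
          int (multiplicity_of (points G) S (induced v (points G) (points P) (jacquet P V))))
       = (if rep_iso (points G) V' S then \<epsilon> else 0))"

definition aubert_dual ::
    "('f::field_char_0 \<Rightarrow> real) \<Rightarrow> ('f alg_closure ^ 'n ^ 'n) set \<Rightarrow> ('f alg_closure ^ 'n ^ 'n) set \<Rightarrow>
     ('f, 'n) irrep set \<Rightarrow> ('f, 'n) irrep set" where
  "aubert_dual v G B \<pi> =
    (THE \<pi>'. \<pi>' \<in> Irr v (points G) \<and> (\<forall>V\<in>\<pi>. \<forall>V'\<in>\<pi>'. is_aubert_dual v G B V V'))"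

text \<open>
  A generic character of \<open>U(F)\<close>, \<open>U\<close> the unipotent radical of \<open>B\<close>, is one that is nontrivial
  on every simple root group relative to \<open>T\<close>. These are the \<open>U \<inter> L\<close>, with \<open>L \<supseteq> T\<close> the Levi
  factor of a minimal parabolic \<open>P\<close> properly containing \<open>B\<close>.
\<close>

definition generic_character ::
    "('f::field_char_0 \<Rightarrow> real) \<Rightarrow> ('f alg_closure ^ 'n ^ 'n) set \<Rightarrow> ('f alg_closure ^ 'n ^ 'n) set \<Rightarrow>
     ('f alg_closure ^ 'n ^ 'n) set \<Rightarrow> ('f ^ 'n ^ 'n \<Rightarrow> complex) \<Rightarrow> bool" where
  "generic_character v G B T \<eta> \<longleftrightarrow>
    (\<forall>u\<in>points (unipotent_radical B). \<eta> u \<noteq> 0) \<and>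
    (\<forall>u\<in>points (unipotent_radical B). \<forall>u'\<in>points (unipotent_radical B).
       \<eta> (u ** u') = \<eta> u * \<eta> u') \<and>
    (\<exists>e>0. \<forall>u\<in>points (unipotent_radical B). near v e u \<longrightarrow> \<eta> u = 1) \<and>
    (\<forall>P L. parabolic base G P \<and> B \<subset> P \<and>
           (\<forall>Q. parabolic base G Q \<and> B \<subset> Q \<and> Q \<subseteq> P \<longrightarrow> Q = P) \<and>
           levi_subgroup base P L \<and> T \<subseteq> L \<longrightarrow>
       (\<exists>u\<in>points (unipotent_radical B \<inter> L). \<eta> u \<noteq> 1))"

text \<open>Generic with respect to some Whittaker datum.\<close>

definition generic_rep ::
    "('f::field_char_0 \<Rightarrow> real) \<Rightarrow> ('f alg_closure ^ 'n ^ 'n) set \<Rightarrow> ('f, 'n) irrep \<Rightarrow> bool" where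
  "generic_rep v G V \<longleftrightarrow>
    (\<exists>B T \<eta> l. rational_borel base G B \<and> levi_subgroup base B T \<and> generic_character v G B T \<eta> \<and>
      (\<forall>x\<in>carrier V. \<forall>y\<in>carrier V. l (x \<oplus>\<^bsub>V\<^esub> y) = l x + (l y :: complex)) \<and>
      (\<forall>c. \<forall>x\<in>carrier V. l (c \<odot>\<^bsub>V\<^esub> x) = c * l x) \<and>
      (\<forall>u\<in>points (unipotent_radical B). \<forall>x\<in>carrier V. l (act V u x) = \<eta> u * l x) \<and>
      (\<exists>x\<in>carrier V. l x \<noteq> 0))"

definition generic ::
    "('f::field_char_0 \<Rightarrow> real) \<Rightarrow> ('f alg_closure ^ 'n ^ 'n) set \<Rightarrow> ('f, 'n) irrep set \<Rightarrow> bool" where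
  "generic v G \<pi> \<longleftrightarrow> \<pi> \<in> Irr v (points G) \<and> (\<forall>V\<in>\<pi>. generic_rep v G V)"


section \<open>The \<open>L\<close>-group\<close>

text \<open>Differential at the identity, computed along real curves in \<open>G\<close> through \<open>1\<close>.\<close>

definition differential ::
    "(complex ^ 'p ^ 'p) set \<Rightarrow> (complex ^ 'p ^ 'p \<Rightarrow> complex ^ 'm ^ 'm) \<Rightarrow>
     complex ^ 'p ^ 'p \<Rightarrow> complex ^ 'm ^ 'm" where
  "differential G f \<xi> =
    (THE Y. \<forall>\<gamma> :: real \<Rightarrow> _. range \<gamma> \<subseteq> G \<and> \<gamma> 0 = mat 1 \<and> (\<gamma> has_vector_derivative \<xi>) (at 0) \<longrightarrow>
       ((\<lambda>t. f (\<gamma> t)) has_vector_derivative Y) (at 0))"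

text \<open>
  \<open>Gd\<close> is the complex dual group of \<open>G\<close>, and \<open>a\<close> is the action of the Weil group on it: it
  preserves a pinning and induces on \<open>X\<^sub>*(Td) = X\<^sup>*(T)\<close> the Galois action. As \<open>B\<close> and \<open>T\<close> are
  defined over \<open>F\<close>, the latter is \<open>(w\<eta>)(t) = w (\<eta> (w\<^sup>-\<^sup>1 t))\<close>.
\<close>

definition L_group_data ::
    "('f::field_char_0 \<Rightarrow> real) \<Rightarrow> ('f alg_closure ^ 'n ^ 'n) set \<Rightarrow> (complex ^ 'm ^ 'm) set \<Rightarrow>
     ('f gal \<Rightarrow> complex ^ 'm ^ 'm \<Rightarrow> complex ^ 'm ^ 'm) \<Rightarrow> bool" where
  "L_group_data v G Gd a \<longleftrightarrow>
    connected_reductive UNIV Gd \<and>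
    (\<exists>B T Bd Td i j E.
      rational_borel base G B \<and> maximal_torus B T \<and> zariski_closed base T \<and>
      borel_subgroup Gd Bd \<and> maximal_torus Bd Td \<and>
      dual_root_data G B T Gd Bd Td i j \<and> pinning Bd Td E \<and>
      (\<forall>w\<in>weil_group v.
         a w \<in> iso (grp Gd) (grp Gd) \<and> alg_hom Gd Gd (a w) \<and>
         a w ` Bd = Bd \<and> a w ` Td = Td \<and> differential Gd (a w) ` E = E \<and>
         (\<forall>\<eta>\<in>carrier (character_group T). \<forall>z. z \<noteq> 0 \<longrightarrow>
            a w (i \<eta> z) =
            i (restrict (\<lambda>t. w (\<eta> (map_matrix (inv_into UNIV w) t))) T) z)) \<and>
      (\<forall>w\<in>weil_group v. \<forall>w'\<in>weil_group v. \<forall>g\<in>Gd. a (w \<circ> w') g = a w (a w' g)))"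

definition LG ::
    "('f::field_char_0 \<Rightarrow> real) \<Rightarrow> (complex ^ 'm ^ 'm) set \<Rightarrow>
     ('f gal \<Rightarrow> complex ^ 'm ^ 'm \<Rightarrow> complex ^ 'm ^ 'm) \<Rightarrow> ((complex ^ 'm ^ 'm) \<times> 'f gal) monoid" where
  "LG v Gd a =
    \<lparr>carrier = Gd \<times> weil_group v,
     mult = (\<lambda>(g, w) (h, w'). (g ** a w h, w \<circ> w')),
     one = (mat 1, id)\<rparr>"

abbreviation LG_topology ::
    "('f::field_char_0 \<Rightarrow> real) \<Rightarrow> (complex ^ 'm ^ 'm) set \<Rightarrow> ((complex ^ 'm ^ 'm) \<times> 'f gal) topology" where
  "LG_topology v Gd \<equiv> prod_topology (top_of_set Gd) (weil_topology v)"

definition LG_conj ::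
    "('f::field_char_0 \<Rightarrow> real) \<Rightarrow> (complex ^ 'm ^ 'm) set \<Rightarrow>
     ('f gal \<Rightarrow> complex ^ 'm ^ 'm \<Rightarrow> complex ^ 'm ^ 'm) \<Rightarrow>
     complex ^ 'm ^ 'm \<Rightarrow> (complex ^ 'm ^ 'm) \<times> 'f gal \<Rightarrow> (complex ^ 'm ^ 'm) \<times> 'f gal" where
  "LG_conj v Gd a g x = (g, id) \<otimes>\<^bsub>LG v Gd a\<^esub> x \<otimes>\<^bsub>LG v Gd a\<^esub> (matrix_inv g, id)"

text \<open>
  The Weil group acts on \<open>Gd\<close> through a finite quotient, so some positive power of any element
  has the form \<open>(h, w)\<close> with \<open>w\<close> acting trivially; in characteristic zero an element is
  semisimple iff such a power is.
\<close>

definition LG_semisimple ::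
    "('f::field_char_0 \<Rightarrow> real) \<Rightarrow> (complex ^ 'm ^ 'm) set \<Rightarrow>
     ('f gal \<Rightarrow> complex ^ 'm ^ 'm \<Rightarrow> complex ^ 'm ^ 'm) \<Rightarrow> (complex ^ 'm ^ 'm) \<times> 'f gal \<Rightarrow> bool" where
  "LG_semisimple v Gd a x \<longleftrightarrow>
    (\<exists>N>0. \<exists>h w. x [^]\<^bsub>LG v Gd a\<^esub> (N :: nat) = (h, w) \<and> (\<forall>g\<in>Gd. a w g = g) \<and>
       (\<exists>p. invertible p \<and> diagonal (conj_mat p h)))"


section \<open>\<open>L\<close>-parameters and Arthur parameters\<close>

type_synonym SL2_matrix = "complex ^ 2 ^ 2"

type_synonym ('f, 'm) L_param = "'f gal \<times> SL2_matrix \<Rightarrow> (complex ^ 'm ^ 'm) \<times> 'f gal"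

type_synonym ('f, 'm) A_param = "'f gal \<times> SL2_matrix \<times> SL2_matrix \<Rightarrow> (complex ^ 'm ^ 'm) \<times> 'f gal"

text \<open>Holomorphic on the complex submanifold \<open>SL_2\<close>: the derivative is complex linear.\<close>

definition analytic_SL2 :: "(SL2_matrix \<Rightarrow> complex ^ 'm ^ 'm) \<Rightarrow> bool" where
  "analytic_SL2 f \<longleftrightarrow>
    (\<forall>x\<in>SL2. \<exists>D. (f has_derivative D) (at x within SL2) \<and>
       (\<forall>c \<xi>. D (mat c ** \<xi>) = mat c ** D \<xi>))"

definition L_parameter ::
    "('f::field_char_0 \<Rightarrow> real) \<Rightarrow> (complex ^ 'm ^ 'm) set \<Rightarrow>
     ('f gal \<Rightarrow> complex ^ 'm ^ 'm \<Rightarrow> complex ^ 'm ^ 'm) \<Rightarrow> ('f, 'm) L_param \<Rightarrow> bool" where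
  "L_parameter v Gd a \<phi> \<longleftrightarrow>
    \<phi> \<in> hom (Weil v \<times>\<times> grp SL2) (LG v Gd a) \<and>
    continuous_map (prod_topology (weil_topology v) (top_of_set SL2)) (LG_topology v Gd) \<phi> \<and>
    (\<forall>w\<in>weil_group v. \<forall>x\<in>SL2. snd (\<phi> (w, x)) = w) \<and>
    analytic_SL2 (\<lambda>x. fst (\<phi> (id, x))) \<and>
    (\<forall>w\<in>weil_group v. LG_semisimple v Gd a (\<phi> (w, mat 1)))"

definition tempered_L_parameter ::
    "('f::field_char_0 \<Rightarrow> real) \<Rightarrow> (complex ^ 'm ^ 'm) set \<Rightarrow>
     ('f gal \<Rightarrow> complex ^ 'm ^ 'm \<Rightarrow> complex ^ 'm ^ 'm) \<Rightarrow> ('f, 'm) L_param \<Rightarrow> bool" where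
  "tempered_L_parameter v Gd a \<phi> \<longleftrightarrow> L_parameter v Gd a \<phi> \<and>
    (\<exists>C. compact C \<and> C \<subseteq> Gd \<and> (\<forall>w\<in>weil_group v. fst (\<phi> (w, mat 1)) \<in> C))"

definition A_parameter ::
    "('f::field_char_0 \<Rightarrow> real) \<Rightarrow> (complex ^ 'm ^ 'm) set \<Rightarrow>
     ('f gal \<Rightarrow> complex ^ 'm ^ 'm \<Rightarrow> complex ^ 'm ^ 'm) \<Rightarrow> ('f, 'm) A_param \<Rightarrow> bool" where
  "A_parameter v Gd a \<psi> \<longleftrightarrow>
    \<psi> \<in> hom (Weil v \<times>\<times> grp SL2 \<times>\<times> grp SL2) (LG v Gd a) \<and>
    continuous_map
      (prod_topology (weil_topology v) (prod_topology (top_of_set SL2) (top_of_set SL2)))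
      (LG_topology v Gd) \<psi> \<and>
    (\<forall>w\<in>weil_group v. \<forall>x\<in>SL2. \<forall>y\<in>SL2. snd (\<psi> (w, x, y)) = w) \<and>
    tempered_L_parameter v Gd a (\<lambda>(w, x). \<psi> (w, x, mat 1)) \<and>
    analytic_SL2 (\<lambda>y. fst (\<psi> (id, mat 1, y)))"

definition tempered_A_parameter :: "('f::field_char_0, 'm::finite) A_param \<Rightarrow> bool" where
  "tempered_A_parameter \<psi> \<longleftrightarrow> (\<forall>y\<in>SL2. \<psi> (id, mat 1, y) = (mat 1, id))"

text \<open>Parameters are considered up to \<open>Gd\<close>-conjugacy.\<close>

definition L_equiv ::
    "('f::field_char_0 \<Rightarrow> real) \<Rightarrow> (complex ^ 'm ^ 'm) set \<Rightarrow>
     ('f gal \<Rightarrow> complex ^ 'm ^ 'm \<Rightarrow> complex ^ 'm ^ 'm) \<Rightarrow> ('f, 'm) L_param \<Rightarrow> ('f, 'm) L_param \<Rightarrow> bool"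
  where "L_equiv v Gd a \<phi> \<phi>' \<longleftrightarrow>
    (\<exists>g\<in>Gd. \<forall>w\<in>weil_group v. \<forall>x\<in>SL2. \<phi>' (w, x) = LG_conj v Gd a g (\<phi> (w, x)))"

definition A_equiv ::
    "('f::field_char_0 \<Rightarrow> real) \<Rightarrow> (complex ^ 'm ^ 'm) set \<Rightarrow>
     ('f gal \<Rightarrow> complex ^ 'm ^ 'm \<Rightarrow> complex ^ 'm ^ 'm) \<Rightarrow> ('f, 'm) A_param \<Rightarrow> ('f, 'm) A_param \<Rightarrow> bool"
  where "A_equiv v Gd a \<psi> \<psi>' \<longleftrightarrow>
    (\<exists>g\<in>Gd. \<forall>w\<in>weil_group v. \<forall>x\<in>SL2. \<forall>y\<in>SL2.
       \<psi>' (w, x, y) = LG_conj v Gd a g (\<psi> (w, x, y)))"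

text \<open>\<open>diag(|w|\<^bsup>1/2\<^esup>, |w|\<^bsup>-1/2\<^esup>)\<close>\<close>

definition norm_diag :: "('f::field_char_0 \<Rightarrow> real) \<Rightarrow> 'f gal \<Rightarrow> SL2_matrix" where
  "norm_diag v w =
    mat2 (complex_of_real (weil_norm v w powr (1 / 2))) 0
         0 (complex_of_real (weil_norm v w powr (- 1 / 2)))"

definition A_to_L :: "('f::field_char_0 \<Rightarrow> real) \<Rightarrow> ('f, 'm) A_param \<Rightarrow> ('f, 'm) L_param" where
  "A_to_L v \<psi> = (\<lambda>(w, x). \<psi> (w, x, norm_diag v w))"

definition A_swap :: "('f::field_char_0, 'm::finite) A_param \<Rightarrow> ('f, 'm) A_param" where
  "A_swap \<psi> = (\<lambda>(w, x, y). \<psi> (w, y, x))"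


section \<open>Vogan varieties and the closure ordering\<close>

type_synonym ('f, 'm) inf_char = "'f gal \<Rightarrow> (complex ^ 'm ^ 'm) \<times> 'f gal"

definition infinitesimal_character ::
    "('f::field_char_0 \<Rightarrow> real) \<Rightarrow> ('f, 'm) L_param \<Rightarrow> ('f, 'm) inf_char" where
  "infinitesimal_character v \<phi> = (\<lambda>w. \<phi> (w, norm_diag v w))"

definition K_group ::
    "('f::field_char_0 \<Rightarrow> real) \<Rightarrow> (complex ^ 'm ^ 'm) set \<Rightarrow>
     ('f gal \<Rightarrow> complex ^ 'm ^ 'm \<Rightarrow> complex ^ 'm ^ 'm) \<Rightarrow> ('f, 'm) inf_char \<Rightarrow> (complex ^ 'm ^ 'm) set"
  where "K_group v Gd a \<nu> = {g \<in> Gd. \<forall>w\<in>inertia_group v.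
     (g, id) \<otimes>\<^bsub>LG v Gd a\<^esub> \<nu> w = \<nu> w \<otimes>\<^bsub>LG v Gd a\<^esub> (g, id)}"

definition H_group ::
    "('f::field_char_0 \<Rightarrow> real) \<Rightarrow> (complex ^ 'm ^ 'm) set \<Rightarrow>
     ('f gal \<Rightarrow> complex ^ 'm ^ 'm \<Rightarrow> complex ^ 'm ^ 'm) \<Rightarrow> ('f, 'm) inf_char \<Rightarrow> (complex ^ 'm ^ 'm) set"
  where "H_group v Gd a \<nu> = {g \<in> Gd. \<forall>w\<in>weil_group v.
     (g, id) \<otimes>\<^bsub>LG v Gd a\<^esub> \<nu> w = \<nu> w \<otimes>\<^bsub>LG v Gd a\<^esub> (g, id)}"

text \<open>The adjoint action of \<open>(g, w)\<close> in the \<open>L\<close>-group on the Lie algebra of \<open>Gd\<close>.\<close>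

definition Ad ::
    "(complex ^ 'm ^ 'm) set \<Rightarrow> ('f gal \<Rightarrow> complex ^ 'm ^ 'm \<Rightarrow> complex ^ 'm ^ 'm) \<Rightarrow>
     (complex ^ 'm ^ 'm) \<times> 'f gal \<Rightarrow> complex ^ 'm ^ 'm \<Rightarrow> complex ^ 'm ^ 'm" where
  "Ad Gd a = (\<lambda>(g, w) \<xi>. conj_mat g (differential Gd (a w) \<xi>))"

definition vogan_variety ::
    "('f::field_char_0 \<Rightarrow> real) \<Rightarrow> (complex ^ 'm ^ 'm) set \<Rightarrow>
     ('f gal \<Rightarrow> complex ^ 'm ^ 'm \<Rightarrow> complex ^ 'm ^ 'm) \<Rightarrow> ('f, 'm) inf_char \<Rightarrow> (complex ^ 'm ^ 'm) set"
  where "vogan_variety v Gd a \<nu> = {\<xi> \<in> lie (K_group v Gd a \<nu>).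
     \<forall>w\<in>weil_group v. Ad Gd a (\<nu> w) \<xi> = mat (complex_of_real (weil_norm v w)) ** \<xi>}"

definition orbit ::
    "('f::field_char_0 \<Rightarrow> real) \<Rightarrow> (complex ^ 'm ^ 'm) set \<Rightarrow>
     ('f gal \<Rightarrow> complex ^ 'm ^ 'm \<Rightarrow> complex ^ 'm ^ 'm) \<Rightarrow> ('f, 'm) inf_char \<Rightarrow>
     complex ^ 'm ^ 'm \<Rightarrow> (complex ^ 'm ^ 'm) set"
  where "orbit v Gd a \<nu> \<xi> = (\<lambda>h. conj_mat h \<xi>) ` H_group v Gd a \<nu>"

definition param_orbit ::
    "('f::field_char_0 \<Rightarrow> real) \<Rightarrow> (complex ^ 'm ^ 'm) set \<Rightarrow>
     ('f gal \<Rightarrow> complex ^ 'm ^ 'm \<Rightarrow> complex ^ 'm ^ 'm) \<Rightarrow> ('f, 'm) L_param \<Rightarrow> (complex ^ 'm ^ 'm) set"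
  where "param_orbit v Gd a \<phi> =
    orbit v Gd a (infinitesimal_character v \<phi>)
      (differential SL2 (\<lambda>x. fst (\<phi> (id, x))) (mat2 0 1 0 0))"

text \<open>
  The ordering of conjugacy classes, hence the choice of representatives with the same
  infinitesimal character. Closures of the orbits in the Zariski and in the Euclidean topology
  agree.
\<close>

definition closure_ge ::
    "('f::field_char_0 \<Rightarrow> real) \<Rightarrow> (complex ^ 'm ^ 'm) set \<Rightarrow>
     ('f gal \<Rightarrow> complex ^ 'm ^ 'm \<Rightarrow> complex ^ 'm ^ 'm) \<Rightarrow> ('f, 'm) L_param \<Rightarrow> ('f, 'm) L_param \<Rightarrow> bool"
  where "closure_ge v Gd a \<phi>\<^sub>1 \<phi>\<^sub>2 \<longleftrightarrow>
    (\<exists>\<phi>\<^sub>1' \<phi>\<^sub>2'. L_equiv v Gd a \<phi>\<^sub>1 \<phi>\<^sub>1' \<and> L_equiv v Gd a \<phi>\<^sub>2 \<phi>\<^sub>2' \<and>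
      (\<forall>w\<in>weil_group v. infinitesimal_character v \<phi>\<^sub>1' w = infinitesimal_character v \<phi>\<^sub>2' w) \<and>
      param_orbit v Gd a \<phi>\<^sub>2' \<subseteq>
        top_of_set (vogan_variety v Gd a (infinitesimal_character v \<phi>\<^sub>1'))
          closure_of (param_orbit v Gd a \<phi>\<^sub>1'))"

text \<open>\<open>\<phi>\<^sub>0\<close> corresponds to the zero orbit in the Vogan variety of the infinitesimal character of \<open>\<phi>\<close>.\<close>

definition zero_orbit_parameter ::
    "('f::field_char_0 \<Rightarrow> real) \<Rightarrow> (complex ^ 'm ^ 'm) set \<Rightarrow>
     ('f gal \<Rightarrow> complex ^ 'm ^ 'm \<Rightarrow> complex ^ 'm ^ 'm) \<Rightarrow> ('f, 'm) L_param \<Rightarrow> ('f, 'm) L_param \<Rightarrow> bool"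
  where "zero_orbit_parameter v Gd a \<phi> \<phi>\<^sub>0 \<longleftrightarrow>
    L_parameter v Gd a \<phi>\<^sub>0 \<and>
    (\<forall>w\<in>weil_group v. infinitesimal_character v \<phi>\<^sub>0 w = infinitesimal_character v \<phi> w) \<and>
    param_orbit v Gd a \<phi>\<^sub>0 = orbit v Gd a (infinitesimal_character v \<phi>) 0"


section \<open>Packets\<close>

text \<open>\<open>llc \<pi>\<close> is a representative of the conjugacy class of the \<open>L\<close>-parameter of \<open>\<pi>\<close>.\<close>

definition L_packet ::
    "('f::field_char_0 \<Rightarrow> real) \<Rightarrow> ('f alg_closure ^ 'n ^ 'n) set \<Rightarrow> (complex ^ 'm ^ 'm) set \<Rightarrow>
     ('f gal \<Rightarrow> complex ^ 'm ^ 'm \<Rightarrow> complex ^ 'm ^ 'm) \<Rightarrow>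
     (('f, 'n) irrep set \<Rightarrow> ('f, 'm) L_param) \<Rightarrow> ('f, 'm) L_param \<Rightarrow> ('f, 'n) irrep set set" where
  "L_packet v G Gd a llc \<phi> = {\<pi> \<in> Irr v (points G). L_equiv v Gd a (llc \<pi>) \<phi>}"

definition local_langlands ::
    "('f::field_char_0 \<Rightarrow> real) \<Rightarrow> ('f alg_closure ^ 'n ^ 'n) set \<Rightarrow> (complex ^ 'm ^ 'm) set \<Rightarrow>
     ('f gal \<Rightarrow> complex ^ 'm ^ 'm \<Rightarrow> complex ^ 'm ^ 'm) \<Rightarrow>
     (('f, 'n) irrep set \<Rightarrow> ('f, 'm) L_param) \<Rightarrow> bool" where
  "local_langlands v G Gd a llc \<longleftrightarrow>
    (\<forall>\<pi>\<in>Irr v (points G). L_parameter v Gd a (llc \<pi>)) \<and>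
    (\<forall>\<phi>. L_parameter v Gd a \<phi> \<longrightarrow>
       finite (L_packet v G Gd a llc \<phi>) \<and> L_packet v G Gd a llc \<phi> \<noteq> {})"

definition arthur_packets ::
    "('f::field_char_0 \<Rightarrow> real) \<Rightarrow> ('f alg_closure ^ 'n ^ 'n) set \<Rightarrow> (complex ^ 'm ^ 'm) set \<Rightarrow>
     ('f gal \<Rightarrow> complex ^ 'm ^ 'm \<Rightarrow> complex ^ 'm ^ 'm) \<Rightarrow>
     (('f, 'n) irrep set \<Rightarrow> ('f, 'm) L_param) \<Rightarrow>
     (('f, 'm) A_param \<Rightarrow> ('f, 'n) irrep set multiset) \<Rightarrow> bool" where
  "arthur_packets v G Gd a llc Pkt \<longleftrightarrow>
    (\<forall>\<psi>. A_parameter v Gd a \<psi> \<longrightarrow>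
       set_mset (Pkt \<psi>) \<subseteq> Irr v (points G) \<and>
       L_packet v G Gd a llc (A_to_L v \<psi>) \<subseteq> set_mset (Pkt \<psi>)) \<and>
    (\<forall>\<psi> \<psi>'. A_parameter v Gd a \<psi> \<and> A_parameter v Gd a \<psi>' \<and> A_equiv v Gd a \<psi> \<psi>' \<longrightarrow>
       Pkt \<psi> = Pkt \<psi>') \<and>
    (\<forall>\<psi> \<psi>'. A_parameter v Gd a \<psi> \<and> A_parameter v Gd a \<psi>' \<and>
       L_equiv v Gd a (A_to_L v \<psi>) (A_to_L v \<psi>') \<longrightarrow> A_equiv v Gd a \<psi> \<psi>')"

definition arthur_type ::
    "('f::field_char_0 \<Rightarrow> real) \<Rightarrow> (complex ^ 'm ^ 'm) set \<Rightarrow>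
     ('f gal \<Rightarrow> complex ^ 'm ^ 'm \<Rightarrow> complex ^ 'm ^ 'm) \<Rightarrow>
     (('f, 'm) A_param \<Rightarrow> ('f, 'n) irrep set multiset) \<Rightarrow> ('f, 'n) irrep set \<Rightarrow> bool" where
  "arthur_type v Gd a Pkt \<pi> \<longleftrightarrow> (\<exists>\<psi>. A_parameter v Gd a \<psi> \<and> \<pi> \<in># Pkt \<psi>)"

end

(*
  Let pi in Pkt psi be generic. Its dual lies in the packet of the swapped parameter, so the closure
  ordering gives that the L-parameter phi_0 of the dual dominates that of the swapped parameter;
  as phi_0 has the zero orbit, which is closed, so has the latter. Its restriction to SL_2 is, up to
  conjugation and an invertible constant factor, the restriction of psi to the Arthur SL_2. Hence
  this homomorphism has zero derivative at the upper triangular nilpotent, kills the upper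
  unipotents and their conjugates, and these generate SL_2.
*)

theory Submission
  imports Defs
begin

section \<open>Homomorphisms from \<open>SL_2\<close> with vanishing derivative\<close>

lemma mat2_nth [simp]:
  "mat2 a b c d $ 1 $ 1 = a" "mat2 a b c d $ 1 $ 2 = b"
  "mat2 a b c d $ 2 $ 1 = c" "mat2 a b c d $ 2 $ 2 = d"
  by (simp_all add: mat2_def)

lemma mat2_mult:
  "mat2 a b c d ** mat2 a' b' c' d' =
    mat2 (a * a' + b * c') (a * b' + b * d') (c * a' + d * c') (c * b' + d * d')"
  by (simp add: vec_eq_iff forall_2 matrix_matrix_mult_def sum_2)

lemma mat_1_eq_mat2: "(mat 1 :: 'k::field ^ 2 ^ 2) = mat2 1 0 0 1"
  by (simp add: vec_eq_iff forall_2 mat_def)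

lemma mat2_eta: "x = mat2 (x $ 1 $ 1) (x $ 1 $ 2) (x $ 2 $ 1) (x $ 2 $ 2)"
  by (simp add: vec_eq_iff forall_2)

lemma mat2_in_SL2: "mat2 a b c d \<in> SL2 \<longleftrightarrow> a * d - b * c = 1"
  by (simp add: SL2_def det_2)

lemma mat_1_in_SL2: "mat 1 \<in> SL2"
  by (simp add: SL2_def)

lemma SL2_mult: "x \<in> SL2 \<Longrightarrow> y \<in> SL2 \<Longrightarrow> x ** y \<in> SL2"
  by (simp add: SL2_def det_mul)

section \<open>Derivatives along curves in \<open>SL2\<close>\<close>

lemma has_vector_derivative_upper_unipotent:
  "((\<lambda>t::real. mat2 1 (complex_of_real t * c) 0 1) has_vector_derivative mat2 0 c 0 0) (at t)"
proof -
  \<comment> \<open>The curve is affine in \<open>t\<close>, so its velocity is constant and the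
    formula holds at every \<open>t\<close>.\<close>
  have eq: "mat2 1 (complex_of_real t * c) 0 1 = mat 1 + t *\<^sub>R mat2 0 c 0 0" for t
    by (simp add: vec_eq_iff forall_2 mat_def) (simp add: scaleR_conv_of_real)
  show ?thesis
    unfolding eq by (auto intro!: derivative_eq_intros)
qed

text \<open>\<open>analytic_SL2\<close> supplies derivatives only within \<open>SL2\<close>; a curve
  that never leaves the set turns them into ordinary derivatives in the real parameter.\<close>

lemma has_vector_derivative_along_curve:
  fixes \<gamma> :: "real \<Rightarrow> 'a::real_normed_vector"
  assumes "(f has_derivative D) (at (\<gamma> t) within S)" "range \<gamma> \<subseteq> S"
    and "(\<gamma> has_vector_derivative \<xi>) (at t)"
  shows "((\<lambda>t. f (\<gamma> t)) has_vector_derivative D \<xi>) (at t)"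
proof -
  have D: "bounded_linear D"
    using assms(1) by (rule has_derivative_bounded_linear)
  have "((\<lambda>t. f (\<gamma> t)) has_derivative (\<lambda>s. D (s *\<^sub>R \<xi>))) (at t)"
    by (rule has_derivative_in_compose[of \<gamma> _ t UNIV f D])
      (use assms in \<open>auto simp: has_vector_derivative_def intro: has_derivative_subset\<close>)
  then show ?thesis
    by (simp add: has_vector_derivative_def linear_simps[OF D])
qed

text \<open>A derivative within \<open>SL2\<close> is determined only on tangent directions. The
  upper nilpotent is one: it is the velocity of the unipotent curve \<open>?\<gamma>\<close>, and
  this single test curve already forces uniqueness in the \<open>THE\<close> of
  \<open>differential\<close>.\<close>

lemma differential_SL2_eq:
  assumes "(f has_derivative D) (at (mat 1) within SL2)"
  shows "differential SL2 f (mat2 0 1 0 0) = D (mat2 0 1 0 0)"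
  unfolding differential_def
proof (rule the_equality)
  show "\<forall>\<gamma>::real \<Rightarrow> _. range \<gamma> \<subseteq> SL2 \<and> \<gamma> 0 = mat 1 \<and>
      (\<gamma> has_vector_derivative mat2 0 1 0 0) (at 0) \<longrightarrow>
      ((\<lambda>t. f (\<gamma> t)) has_vector_derivative D (mat2 0 1 0 0)) (at 0)"
    using assms by (metis has_vector_derivative_along_curve)
next
  fix Y
  assume Y: "\<forall>\<gamma>::real \<Rightarrow> _. range \<gamma> \<subseteq> SL2 \<and> \<gamma> 0 = mat 1 \<and>
      (\<gamma> has_vector_derivative mat2 0 1 0 0) (at 0) \<longrightarrow>
      ((\<lambda>t. f (\<gamma> t)) has_vector_derivative Y) (at 0)"
  let ?\<gamma> = "\<lambda>t::real. mat2 1 (complex_of_real t * 1) 0 1"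
  have \<gamma>: "range ?\<gamma> \<subseteq> SL2" "?\<gamma> 0 = mat 1"
    by (auto simp: mat2_in_SL2 mat_1_eq_mat2)
  have "((\<lambda>t. f (?\<gamma> t)) has_vector_derivative Y) (at 0)"
    using Y \<gamma> has_vector_derivative_upper_unipotent[of 1 0] by blast
  moreover have "((\<lambda>t. f (?\<gamma> t)) has_vector_derivative D (mat2 0 1 0 0)) (at 0)"
    by (rule has_vector_derivative_along_curve[where S = SL2])
      (use assms \<gamma> has_vector_derivative_upper_unipotent[of 1 0] in auto)
  ultimately show "Y = D (mat2 0 1 0 0)"
    by (rule vector_derivative_unique_at)
qed

text \<open>The two-sided form serves both conjugation and, with \<open>mat 1\<close> on the right,
  left multiplication. Real linearity suffices in finite dimension.\<close>

lemma bounded_linear_mat_mult: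
  fixes P Q :: "complex ^ 'm ^ 'm"
  shows "bounded_linear (\<lambda>\<xi>. P ** \<xi> ** Q)"
proof -
  have "linear (\<lambda>\<xi>. P ** \<xi> ** Q)"
    by (rule linearI)
      (simp_all add: vec_eq_iff matrix_matrix_mult_def algebra_simps sum.distrib
        scaleR_sum_right sum_distrib_left sum_distrib_right)
  then show ?thesis
    by (simp add: linear_conv_bounded_linear)
qed

section \<open>Matrix inverses and conjugation\<close>

lemma matrix_inv_mult:
  fixes g :: "'k::field ^ 'n ^ 'n"
  assumes "invertible g"
  shows "g ** matrix_inv g = mat 1" "matrix_inv g ** g = mat 1"
  using assms someI_ex[of "\<lambda>h. g ** h = mat 1 \<and> h ** g = mat 1"]
  by (auto simp: invertible_def matrix_inv_def)

lemma matrix_inv_unique: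
  fixes g :: "'k::field ^ 'n ^ 'n"
  assumes "g ** h = mat 1" "h ** g = mat 1"
  shows "matrix_inv g = h"
  by (metis assms invertible_def matrix_inv_mult(1) matrix_mul_assoc matrix_mul_lid matrix_mul_rid)

lemma conj_mat_eq_0_iff: "invertible g \<Longrightarrow> conj_mat g x = 0 \<longleftrightarrow> x = 0"
  for g :: "'k::field ^ 'n ^ 'n"
proof
  assume g: "invertible g" and "conj_mat g x = 0"
  then have "matrix_inv g ** (g ** x ** matrix_inv g) ** g = 0"
    by (simp add: conj_mat_def)
  then show "x = 0"
    using g by (metis matrix_mul_assoc matrix_inv_mult(2) matrix_mul_lid matrix_mul_rid)
qed (simp add: conj_mat_def)

lemma matrix_inv_mat_1: "matrix_inv (mat 1 :: 'k::field ^ 'n ^ 'n) = mat 1"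
  by (rule matrix_inv_unique) simp_all

lemma conj_mat_1: "conj_mat (mat 1) x = (x :: 'k::field ^ 'n ^ 'n)"
  by (simp add: conj_mat_def matrix_inv_mat_1)

text \<open>Left translation by \<open>u s\<close> carries the zero derivative at \<open>0\<close>
  to \<open>s\<close>, so the derivative vanishes everywhere and \<open>u\<close> is
  constant.\<close>

lemma one_parameter_group_trivial:
  fixes u :: "real \<Rightarrow> complex ^ 'm ^ 'm"
  assumes add: "\<And>s t. u (s + t) = u s ** u t"
    and deriv: "(u has_vector_derivative 0) (at 0)"
  shows "u s = u 0"
proof -
  have "(u has_vector_derivative 0) (at s)" for s
  proof -
    \<comment> \<open>The trailing \<open>mat 1\<close> brings the translate into the shape of
      \<open>bounded_linear_mat_mult\<close>.\<close>
    have "((\<lambda>t. u s ** u t ** mat 1) has_derivative (\<lambda>r. u s ** (r *\<^sub>R 0) ** mat 1)) (at 0)"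
      using bounded_linear.has_derivative[OF bounded_linear_mat_mult]
        deriv[unfolded has_vector_derivative_def] by blast
    then have "((\<lambda>t. u (s + t)) has_derivative (\<lambda>r. 0)) (at 0)"
      by (simp add: add)
    then have "((\<lambda>t. u (s + (t - s))) has_derivative (\<lambda>r. 0)) (at s)"
      by (intro has_derivative_compose[of "\<lambda>t. t - s" "\<lambda>t. t" s UNIV "\<lambda>t. u (s + t)" "\<lambda>r. 0"])
        (auto intro!: derivative_eq_intros)
    then show ?thesis
      by (simp add: has_vector_derivative_def)
  qed
  then obtain k where "\<And>t. u t = k"
    using has_derivative_zero_constant[of UNIV u] by (auto simp: has_vector_derivative_def)
  then show ?thesis
    by simp
qed

text \<open>Upper unipotents generate \<open>SL2\<close> together with their conjugates: a Weyl
  element conjugates them to the lower ones, a matrix with \<open>c \<noteq> 0\<close> is a product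
  upper, lower, upper, and the remaining matrices are moved into that case.\<close>

lemma SL2_hom_trivial_if_trivial_on_unipotents:
  fixes h :: "complex ^ 2 ^ 2 \<Rightarrow> complex ^ 'm ^ 'm"
  assumes mult: "\<And>x y. x \<in> SL2 \<Longrightarrow> y \<in> SL2 \<Longrightarrow> h (x ** y) = h x ** h y"
    and one: "h (mat 1) = mat 1"
    and upper: "\<And>c. h (mat2 1 c 0 1) = mat 1"
    and "x \<in> SL2"
  shows "h x = mat 1"
proof -
  have lower: "h (mat2 1 0 c 1) = mat 1" for c
  proof -
    let ?s = "mat2 0 1 (-1) 0 :: complex ^ 2 ^ 2" and ?s' = "mat2 0 (-1) 1 0 :: complex ^ 2 ^ 2"
    have s: "?s \<in> SL2" "?s' \<in> SL2" "mat2 1 (- c) 0 1 \<in> SL2"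
      by (simp_all add: mat2_in_SL2)
    \<comment> \<open>Here \<open>?s'\<close> is the inverse of the Weyl element \<open>?s\<close>.
      The unipotent in the middle is killed by \<open>h\<close>, which leaves the image of
      \<open>?s ** ?s' = mat 1\<close>.\<close>
    have "mat2 1 0 c 1 = ?s ** mat2 1 (- c) 0 1 ** ?s'"
      by (simp add: mat2_mult)
    then have "h (mat2 1 0 c 1) = h ?s ** h ?s'"
      using s by (simp add: mult SL2_mult upper)
    also have "\<dots> = h (?s ** ?s')"
      using s by (simp add: mult)
    finally show ?thesis
      by (simp add: mat2_mult flip: mat_1_eq_mat2 one)
  qed
  have case_c: "h (mat2 a b c d) = mat 1" if "a * d - b * c = 1" "c \<noteq> 0" for a b c d
  proof -
    have "mat2 a b c d = mat2 1 ((a - 1) / c) 0 1 ** mat2 1 0 c 1 ** mat2 1 ((d - 1) / c) 0 1"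
      using that by (simp add: mat2_mult field_simps)
    then show ?thesis
      by (simp add: mult SL2_mult mat2_in_SL2 upper lower)
  qed
  obtain a b c d where x: "x = mat2 a b c d"
    using mat2_eta by blast
  have det: "a * d - b * c = 1"
    using \<open>x \<in> SL2\<close> by (simp add: x mat2_in_SL2)
  show ?thesis
  proof (cases "c = 0")
    case True
    then have "a \<noteq> 0"
      using det by auto
    \<comment> \<open>The product has lower left entry \<open>a\<close>, which is nonzero, so
      \<open>case_c\<close> applies; the lower unipotent factor is already known to map to
      \<open>mat 1\<close>.\<close>
    have "mat2 1 0 1 1 ** x \<in> SL2"
      by (simp add: SL2_mult mat2_in_SL2 \<open>x \<in> SL2\<close>)
    then have "h (mat2 1 0 1 1 ** x) = mat 1"
      using \<open>a \<noteq> 0\<close> True by (simp add: x mat2_mult mat2_in_SL2 case_c)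
    then show ?thesis
      using \<open>x \<in> SL2\<close> by (simp add: mult mat2_in_SL2 lower)
  next
    case False
    then show ?thesis
      using case_c det by (simp add: x)
  qed
qed

text \<open>Complex linearity spreads the vanishing of \<open>D\<close> from the nilpotent to all
  its complex multiples. Hence for each complex \<open>c\<close> the real one-parameter group with
  velocity \<open>mat2 0 c 0 0\<close> has a constant image.\<close>

lemma SL2_hom_trivial_if_derivative_zero:
  fixes h :: "complex ^ 2 ^ 2 \<Rightarrow> complex ^ 'm ^ 'm"
  assumes mult: "\<And>x y. x \<in> SL2 \<Longrightarrow> y \<in> SL2 \<Longrightarrow> h (x ** y) = h x ** h y"
    and one: "h (mat 1) = mat 1"
    and D: "(h has_derivative D) (at (mat 1) within SL2)"
    and linear: "\<And>c \<xi>. D (mat c ** \<xi>) = mat c ** D \<xi>"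
    and zero: "D (mat2 0 1 0 0) = 0"
    and "x \<in> SL2"
  shows "h x = mat 1"
proof (rule SL2_hom_trivial_if_trivial_on_unipotents[OF mult one _ \<open>x \<in> SL2\<close>])
  fix c
  let ?\<gamma> = "\<lambda>t::real. mat2 1 (complex_of_real t * c) 0 1"
  have "mat2 0 c 0 0 = mat c ** mat2 0 1 0 0"
    by (simp add: vec_eq_iff forall_2 matrix_matrix_mult_def sum_2 mat_def)
  then have "D (mat2 0 c 0 0) = 0"
    by (simp add: linear zero)
  moreover have "((\<lambda>t. h (?\<gamma> t)) has_vector_derivative D (mat2 0 c 0 0)) (at 0)"
    by (rule has_vector_derivative_along_curve[where S = SL2])
      (use D has_vector_derivative_upper_unipotent[of c 0] in
        \<open>auto simp: mat2_in_SL2 mat_1_eq_mat2\<close>)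
  ultimately have "((\<lambda>t. h (?\<gamma> t)) has_vector_derivative 0) (at 0)"
    by simp
  moreover have "h (?\<gamma> (s + t)) = h (?\<gamma> s) ** h (?\<gamma> t)" for s t
    by (simp add: mat2_in_SL2 mat2_mult algebra_simps flip: mult)
  ultimately have "h (?\<gamma> 1) = h (?\<gamma> 0)"
    by (rule one_parameter_group_trivial[rotated])
  then show "h (mat2 1 c 0 1) = mat 1"
    by (simp add: one flip: mat_1_eq_mat2)
qed

section \<open>The Weil group and the \<open>L\<close>-group\<close>

lemma nonarch_local_field_one:
  assumes "nonarch_local_field v"
  shows "v 1 = 1"
proof -
  have "v (1 * 1) = v 1 * v 1" "v 1 \<noteq> 0"
    using assms by (simp_all only: nonarch_local_field_def) simp_all
  then show ?thesis
    by simp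
qed

lemma id_in_weil_group:
  assumes "nonarch_local_field v"
  shows "id \<in> weil_group v"
proof -
  have "v 0 = 0"
    using assms by (simp add: nonarch_local_field_def)
  \<comment> \<open>The polynomial \<open>X\<close> shows that \<open>0\<close> is integral. This is
    all that is at stake, since for the identity the Frobenius congruence of degree \<open>0\<close>
    reads \<open>z - z = 0\<close>.\<close>
  then have "\<forall>i. v (poly.coeff [:0, 1:] i) \<le> 1"
    using nonarch_local_field_one[OF assms] by (auto simp: coeff_pCons split: nat.splits)
  then have "0 \<in> integers_bar v"
    unfolding integers_bar_def by (auto simp: map_poly_pCons intro!: exI[of _ "[:0, 1:]"])
  then have "frobenius_power v id 0"
    by (simp add: frobenius_power_def max_ideal_bar_def)
  then show ?thesis
    by (auto simp: weil_group_def galois_group_def)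
qed

lemma norm_diag_in_SL2:
  assumes "nonarch_local_field v"
  shows "norm_diag v w \<in> SL2"
proof -
  have "v 0 = 0" and fin: "finite ((\<lambda>x. {y. v (y - x) < 1}) ` {x. v x \<le> 1})"
    using assms by (simp_all add: nonarch_local_field_def)
  then have "v 0 \<le> 1"
    by simp
  then have "residue_card v > 0"
    using fin by (auto simp: residue_card_def card_gt_0_iff)
  \<comment> \<open>An integer power of a positive number is positive whatever the value of
    \<open>weil_degree\<close>; the claim therefore holds for every \<open>w\<close>.\<close>
  then have "weil_norm v w > 0"
    by (simp add: weil_norm_def)
  then have "weil_norm v w powr (1 / 2) * weil_norm v w powr (- 1 / 2) = 1"
    by (simp flip: powr_add)
  then show ?thesis
    by (simp add: norm_diag_def mat2_in_SL2 flip: of_real_mult)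
qed

section \<open>The dual group, the Weil action on it and the \<open>L\<close>-group\<close>

locale L_group =
  fixes v :: "'f::field_char_0 \<Rightarrow> real"
    and Gd :: "(complex ^ 'm ^ 'm) set"
    and a :: "'f gal \<Rightarrow> complex ^ 'm ^ 'm \<Rightarrow> complex ^ 'm ^ 'm"
  assumes local_field: "nonarch_local_field v"
    and subgroup_dual: "subgroup Gd GL"
    and action_iso: "w \<in> weil_group v \<Longrightarrow> a w \<in> iso (grp Gd) (grp Gd)"
    and action_comp: "w \<in> weil_group v \<Longrightarrow> w' \<in> weil_group v \<Longrightarrow> g \<in> Gd \<Longrightarrow>
      a (w \<circ> w') g = a w (a w' g)"
begin

lemma id_weil: "id \<in> weil_group v"
  using local_field by (rule id_in_weil_group)

lemma norm_diag: "norm_diag v w \<in> SL2"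
  using local_field by (rule norm_diag_in_SL2)

lemma dual_mult: "g \<in> Gd \<Longrightarrow> h \<in> Gd \<Longrightarrow> g ** h \<in> Gd"
  using subgroup.m_closed[OF subgroup_dual] by (simp add: GL_def)

lemma dual_one: "mat 1 \<in> Gd"
  using subgroup.one_closed[OF subgroup_dual] by (simp add: GL_def)

lemma dual_invertible: "g \<in> Gd \<Longrightarrow> invertible g"
  using subgroup.subset[OF subgroup_dual] by (auto simp: GL_def)

lemma dual_inv:
  assumes "g \<in> Gd"
  shows "matrix_inv g \<in> Gd"
proof -
  have g: "invertible g"
    using assms by (rule dual_invertible)
  then have inv: "invertible (matrix_inv g)"
    using matrix_inv_mult by (auto simp: invertible_def)
  \<comment> \<open>Closure of a subgroup under inverses speaks of the group inverse in
    \<open>GL\<close>, which has to be matched with \<open>matrix_inv\<close>.\<close>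
  have "inv\<^bsub>GL\<^esub> g = matrix_inv g"
    unfolding m_inv_def
  proof (rule the_equality)
    show "matrix_inv g \<in> carrier GL \<and> g \<otimes>\<^bsub>GL\<^esub> matrix_inv g = \<one>\<^bsub>GL\<^esub> \<and>
        matrix_inv g \<otimes>\<^bsub>GL\<^esub> g = \<one>\<^bsub>GL\<^esub>"
      using g inv by (simp add: GL_def matrix_inv_mult)
  next
    fix h
    assume "h \<in> carrier GL \<and> g \<otimes>\<^bsub>GL\<^esub> h = \<one>\<^bsub>GL\<^esub> \<and> h \<otimes>\<^bsub>GL\<^esub> g = \<one>\<^bsub>GL\<^esub>"
    then show "h = matrix_inv g"
      using matrix_inv_unique[of g h] by (simp add: GL_def)
  qed
  then show ?thesis
    using subgroup.m_inv_closed[OF subgroup_dual assms] by simp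
qed

lemma action_closed: "w \<in> weil_group v \<Longrightarrow> g \<in> Gd \<Longrightarrow> a w g \<in> Gd"
  using action_iso[of w] by (auto simp: iso_def hom_def)

text \<open>The image of the identity is idempotent and invertible.\<close>

lemma action_one:
  assumes "w \<in> weil_group v"
  shows "a w (mat 1) = mat 1"
proof -
  have "a w (mat 1) = a w (mat 1) ** a w (mat 1)"
    using action_iso[OF assms] dual_one
    by (auto simp: iso_def hom_def GL_def dest!: bspec[of _ _ "mat 1"])
  moreover have "invertible (a w (mat 1))"
    using action_closed[OF assms dual_one] by (rule dual_invertible)
  ultimately show ?thesis
    by (metis matrix_inv_mult(2) matrix_mul_assoc matrix_mul_lid)
qed

text \<open>Triviality of \<open>a id\<close> is not an axiom of the locale: multiplicativity makes
  \<open>a id\<close> idempotent on \<open>Gd\<close>, and injectivity cancels one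
  application.\<close>

lemma action_id:
  assumes "g \<in> Gd"
  shows "a id g = g"
proof -
  have "inj_on (a id) Gd"
    using action_iso[OF id_weil] by (simp add: iso_def bij_betw_def)
  moreover have "a id (a id g) = a id g"
    using action_comp[OF id_weil id_weil assms] by simp
  ultimately show ?thesis
    using assms action_closed[OF id_weil assms] by (auto dest: inj_onD)
qed

lemma carrier_LG: "carrier (LG v Gd a) = Gd \<times> weil_group v"
  by (simp add: LG_def)

lemma LG_mult: "(g, w) \<otimes>\<^bsub>LG v Gd a\<^esub> (h, w') = (g ** a w h, w \<circ> w')"
  by (simp add: LG_def)

text \<open>In the semidirect product the inverse on the right is twisted by the Weil component of
  \<open>x\<close>; over \<open>id\<close> this becomes ordinary conjugation.\<close>

lemma LG_conj_eq:
  assumes "g \<in> Gd" "x \<in> Gd \<times> weil_group v"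
  shows "LG_conj v Gd a g x = (g ** fst x ** a (snd x) (matrix_inv g), snd x)"
  using assms by (auto simp: LG_conj_def LG_mult action_id)

lemma LG_conj_closed:
  assumes "g \<in> Gd" "x \<in> Gd \<times> weil_group v"
  shows "LG_conj v Gd a g x \<in> Gd \<times> weil_group v"
  using assms by (auto simp: LG_conj_eq intro!: dual_mult action_closed dual_inv)

lemma mat_1_in_H_group:
  assumes "\<And>w. w \<in> weil_group v \<Longrightarrow> \<nu> w \<in> Gd \<times> weil_group v"
  shows "mat 1 \<in> H_group v Gd a \<nu>"
proof -
  have "(mat 1, id) \<otimes>\<^bsub>LG v Gd a\<^esub> \<nu> w = \<nu> w \<otimes>\<^bsub>LG v Gd a\<^esub> (mat 1, id)"
    if w: "w \<in> weil_group v" for w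
  proof -
    obtain g w' where "\<nu> w = (g, w')" "g \<in> Gd" "w' \<in> weil_group v"
      using assms[OF w] by blast
    then show ?thesis
      by (simp add: LG_mult action_id action_one)
  qed
  then show ?thesis
    by (simp add: H_group_def dual_one)
qed

section \<open>Derivatives of parameters along the Deligne \<open>SL_2\<close>\<close>

lemma param_orbit_subset_zero:
  assumes "((\<lambda>x. fst (\<phi> (id, x))) has_derivative D) (at (mat 1) within SL2)"
    and "D (mat2 0 1 0 0) = 0"
  shows "param_orbit v Gd a \<phi> \<subseteq> {0}"
  using assms by (auto simp: param_orbit_def orbit_def differential_SL2_eq conj_mat_def)

text \<open>The base point of the orbit is recovered by acting with \<open>mat 1\<close>. The last
  assumption puts the infinitesimal character inside the \<open>L\<close>-group, so that
  \<open>mat 1\<close> belongs to \<open>H_group\<close>.\<close>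

lemma derivative_zero_if_param_orbit_zero:
  assumes "param_orbit v Gd a \<phi> \<subseteq> {0}"
    and "((\<lambda>x. fst (\<phi> (id, x))) has_derivative D) (at (mat 1) within SL2)"
    and "\<And>w. w \<in> weil_group v \<Longrightarrow> \<phi> (w, norm_diag v w) \<in> Gd \<times> weil_group v"
  shows "D (mat2 0 1 0 0) = 0"
proof -
  have "mat 1 \<in> H_group v Gd a (infinitesimal_character v \<phi>)"
    using assms(3) by (simp add: mat_1_in_H_group infinitesimal_character_def)
  then have "conj_mat (mat 1) (D (mat2 0 1 0 0)) \<in> param_orbit v Gd a \<phi>"
    using assms(2) by (auto simp: param_orbit_def orbit_def differential_SL2_eq)
  then show ?thesis
    using assms(1) by (auto simp: conj_mat_1)
qed

text \<open>Over the identity of the Weil group, equivalence is conjugation by a fixed matrix. This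
  is a linear map, so it passes to the derivative.\<close>

lemma has_derivative_L_equiv:
  assumes "L_equiv v Gd a \<phi> \<phi>'"
    and "\<And>x. x \<in> SL2 \<Longrightarrow> \<phi> (id, x) \<in> Gd \<times> {id}"
    and D: "((\<lambda>x. fst (\<phi> (id, x))) has_derivative D) (at (mat 1) within SL2)"
  obtains g where "invertible g"
    and "((\<lambda>x. fst (\<phi>' (id, x))) has_derivative (\<lambda>\<xi>. conj_mat g (D \<xi>))) (at (mat 1) within SL2)"
proof -
  obtain g where g: "g \<in> Gd"
    and conj: "\<And>x. x \<in> SL2 \<Longrightarrow> \<phi>' (id, x) = LG_conj v Gd a g (\<phi> (id, x))"
    using assms(1) id_weil by (auto simp: L_equiv_def)
  have eq: "fst (\<phi>' (id, x)) = g ** fst (\<phi> (id, x)) ** matrix_inv g" if "x \<in> SL2" for x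
  proof -
    have "\<phi> (id, x) \<in> Gd \<times> weil_group v" "snd (\<phi> (id, x)) = id"
      using assms(2)[OF that] id_weil by auto
    then show ?thesis
      by (simp add: conj[OF that] LG_conj_eq g action_id dual_inv)
  qed
  have "((\<lambda>x. fst (\<phi>' (id, x))) has_derivative (\<lambda>\<xi>. conj_mat g (D \<xi>))) (at (mat 1) within SL2)"
    unfolding conj_mat_def
    by (rule has_derivative_transform[OF mat_1_in_SL2 eq
          bounded_linear.has_derivative[OF bounded_linear_mat_mult D]])
  then show thesis
    using that dual_invertible[OF g] by blast
qed

section \<open>Values and products of parameters\<close>

lemma L_parameter_closed:
  assumes "L_parameter v Gd a \<phi>" "w \<in> weil_group v" "x \<in> SL2"
  shows "\<phi> (w, x) \<in> Gd \<times> {w}"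
proof -
  have "\<phi> \<in> hom (Weil v \<times>\<times> grp SL2) (LG v Gd a)" and "snd (\<phi> (w, x)) = w"
    using assms by (simp_all add: L_parameter_def)
  moreover have "(w, x) \<in> carrier (Weil v \<times>\<times> grp SL2)"
    using assms(2,3) by (simp add: Weil_def)
  ultimately have "\<phi> (w, x) \<in> carrier (LG v Gd a)" "snd (\<phi> (w, x)) = w"
    by (simp_all only: hom_in_carrier)
  then show ?thesis
    by (cases "\<phi> (w, x)") (auto simp: carrier_LG)
qed

lemma L_parameter_derivative:
  assumes "L_parameter v Gd a \<phi>"
  obtains D where "((\<lambda>x. fst (\<phi> (id, x))) has_derivative D) (at (mat 1) within SL2)"
  using assms mat_1_in_SL2 by (auto simp: L_parameter_def analytic_SL2_def)

lemma A_parameter_closed: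
  assumes "A_parameter v Gd a \<psi>" "w \<in> weil_group v" "x \<in> SL2" "y \<in> SL2"
  shows "\<psi> (w, x, y) \<in> Gd \<times> {w}"
proof -
  have "\<psi> \<in> hom (Weil v \<times>\<times> grp SL2 \<times>\<times> grp SL2) (LG v Gd a)" and "snd (\<psi> (w, x, y)) = w"
    using assms by (simp_all add: A_parameter_def)
  moreover have "(w, x, y) \<in> carrier (Weil v \<times>\<times> grp SL2 \<times>\<times> grp SL2)"
    using assms(2-4) by (simp add: Weil_def)
  ultimately have "\<psi> (w, x, y) \<in> carrier (LG v Gd a)" "snd (\<psi> (w, x, y)) = w"
    by (simp_all only: hom_in_carrier)
  then show ?thesis
    by (cases "\<psi> (w, x, y)") (auto simp: carrier_LG)
qed

text \<open>Over the identity of the Weil group the twist disappears, so the first component is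
  multiplicative on the two \<open>SL2\<close> factors.\<close>

lemma A_parameter_mult_id:
  assumes "A_parameter v Gd a \<psi>" "x \<in> SL2" "y \<in> SL2" "x' \<in> SL2" "y' \<in> SL2"
  shows "fst (\<psi> (id, x ** x', y ** y')) = fst (\<psi> (id, x, y)) ** fst (\<psi> (id, x', y'))"
proof -
  have "\<psi> ((id, x, y) \<otimes>\<^bsub>Weil v \<times>\<times> grp SL2 \<times>\<times> grp SL2\<^esub> (id, x', y')) =
      \<psi> (id, x, y) \<otimes>\<^bsub>LG v Gd a\<^esub> \<psi> (id, x', y')"
    using assms id_weil by (intro hom_mult) (auto simp: A_parameter_def Weil_def)
  then have "\<psi> (id, x ** x', y ** y') = \<psi> (id, x, y) \<otimes>\<^bsub>LG v Gd a\<^esub> \<psi> (id, x', y')"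
    by (simp add: Weil_def GL_def)
  moreover obtain g h where "\<psi> (id, x, y) = (g, id)" "\<psi> (id, x', y') = (h, id)" "h \<in> Gd"
    using A_parameter_closed[OF assms(1) id_weil] assms(2-) by blast
  ultimately show ?thesis
    by (simp add: LG_mult action_id)
qed

lemma A_parameter_one:
  assumes "A_parameter v Gd a \<psi>"
  shows "fst (\<psi> (id, mat 1, mat 1)) = mat 1"
proof -
  let ?g = "fst (\<psi> (id, mat 1, mat 1))"
  have "?g = ?g ** ?g"
    using A_parameter_mult_id[OF assms mat_1_in_SL2 mat_1_in_SL2 mat_1_in_SL2 mat_1_in_SL2]
    by (simp only: matrix_mul_lid)
  moreover have "invertible ?g"
    using A_parameter_closed[OF assms id_weil mat_1_in_SL2 mat_1_in_SL2]
    by (intro dual_invertible) (auto simp: mem_Times_iff)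
  ultimately show ?thesis
    by (metis matrix_inv_mult(2) matrix_mul_assoc matrix_mul_lid)
qed

text \<open>Boundedness and semisimplicity constrain only the values at
  \<open>(w, mat 1, mat 1)\<close>, which the swap fixes. The two analyticity conditions are
  exchanged.\<close>

lemma A_parameter_A_swap:
  assumes \<psi>: "A_parameter v Gd a \<psi>"
  shows "A_parameter v Gd a (A_swap \<psi>)"
proof -
  let ?D = "Weil v \<times>\<times> grp SL2 \<times>\<times> grp (SL2 :: SL2_matrix set)"
  let ?X = "prod_topology (weil_topology v)
    (prod_topology (top_of_set SL2) (top_of_set (SL2 :: SL2_matrix set)))"
  let ?s = "\<lambda>(w :: 'f gal, x :: SL2_matrix, y :: SL2_matrix). (w, y, x)"
  let ?i = "\<lambda>(w :: 'f gal, x :: SL2_matrix). (w, mat 1 :: SL2_matrix, x)"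
  have swap: "A_swap \<psi> = \<psi> \<circ> ?s"
    by (auto simp: A_swap_def)
  \<comment> \<open>The restriction of the swapped parameter to the first \<open>SL2\<close> is
    \<open>\<psi>\<close> on the Arthur factor, written as a composition so that homomorphy and
    continuity are inherited.\<close>
  have res: "(\<lambda>(w, x). A_swap \<psi> (w, x, mat 1)) = \<psi> \<circ> ?i"
    by (auto simp: A_swap_def)
  have hom: "\<psi> \<in> hom ?D (LG v Gd a)"
    and cont: "continuous_map ?X (LG_topology v Gd) \<psi>"
    and proj: "\<And>w x y. w \<in> weil_group v \<Longrightarrow> x \<in> SL2 \<Longrightarrow> y \<in> SL2 \<Longrightarrow> snd (\<psi> (w, x, y)) = w"
    and temp: "tempered_L_parameter v Gd a (\<lambda>(w, x). \<psi> (w, x, mat 1))"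
    and ana: "analytic_SL2 (\<lambda>y. fst (\<psi> (id, mat 1, y)))"
    using \<psi> by (auto simp: A_parameter_def)
  have ana': "analytic_SL2 (\<lambda>x. fst (\<psi> (id, x, mat 1)))"
    using temp by (simp add: tempered_L_parameter_def L_parameter_def)
  have s: "?s \<in> hom ?D ?D"
    by (auto simp: hom_def)
  have i: "?i \<in> hom (Weil v \<times>\<times> grp SL2) ?D"
    by (auto simp: hom_def GL_def mat_1_in_SL2)
  have cs: "continuous_map ?X ?X ?s"
    unfolding case_prod_unfold continuous_map_paired
    using continuous_map_fst continuous_map_compose[OF continuous_map_snd continuous_map_fst]
      continuous_map_compose[OF continuous_map_snd continuous_map_snd]
    by (simp only: o_def) blast
  have ci: "continuous_map (prod_topology (weil_topology v) (top_of_set SL2)) ?X ?i"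
    unfolding case_prod_unfold continuous_map_paired
    by (simp add: continuous_map_fst continuous_map_snd mat_1_in_SL2)
  have "L_parameter v Gd a (\<psi> \<circ> ?i)"
    unfolding L_parameter_def
  proof (intro conjI)
    show "\<psi> \<circ> ?i \<in> hom (Weil v \<times>\<times> grp SL2) (LG v Gd a)"
      using hom_compose[OF i hom] .
    show "continuous_map (prod_topology (weil_topology v) (top_of_set SL2)) (LG_topology v Gd)
        (\<psi> \<circ> ?i)"
      using continuous_map_compose[OF ci cont] .
    show "\<forall>w\<in>weil_group v. LG_semisimple v Gd a ((\<psi> \<circ> ?i) (w, mat 1))"
      using temp by (simp add: tempered_L_parameter_def L_parameter_def)
  qed (use proj ana in \<open>simp_all add: mat_1_in_SL2\<close>)
  then have "tempered_L_parameter v Gd a (\<psi> \<circ> ?i)"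
    using temp by (simp add: tempered_L_parameter_def)
  then show ?thesis
    unfolding A_parameter_def res
    using hom_compose[OF s hom] continuous_map_compose[OF cs cont] proj ana'
    by (simp add: swap)
qed

lemma tempered_if_param_orbit_zero:
  assumes \<psi>: "A_parameter v Gd a \<psi>"
    and eq: "L_equiv v Gd a (A_to_L v (A_swap \<psi>)) \<phi>"
    and orbit: "param_orbit v Gd a \<phi> \<subseteq> {0}"
  shows "tempered_A_parameter \<psi>"
proof -
  let ?\<phi> = "A_to_L v (A_swap \<psi>)"
  let ?h = "\<lambda>y. fst (\<psi> (id, mat 1, y))"
  \<comment> \<open>After the swap the norm matrix occupies the Deligne slot of
    \<open>\<psi>\<close>, and the variable \<open>x\<close> the Arthur slot.\<close>
  have val: "?\<phi> (w, x) = \<psi> (w, norm_diag v w, x)" for w x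
    by (simp add: A_to_L_def A_swap_def)
  have closed: "?\<phi> (w, x) \<in> Gd \<times> {w}" if "w \<in> weil_group v" "x \<in> SL2" for w x
    using A_parameter_closed[OF \<psi> that(1) norm_diag that(2)] by (simp add: val)
  obtain D where D: "(?h has_derivative D) (at (mat 1) within SL2)"
    and linear: "\<And>c \<xi>. D (mat c ** \<xi>) = mat c ** D \<xi>"
    using \<psi> mat_1_in_SL2 unfolding A_parameter_def analytic_SL2_def by blast
  \<comment> \<open>In fact \<open>P = 1\<close>, but this needs the uniqueness of the degree of \<open>id\<close>; invertibility suffices.\<close>
  define P where "P = fst (\<psi> (id, norm_diag v id, mat 1))"
  have P: "invertible P"
    unfolding P_def using A_parameter_closed[OF \<psi> id_weil norm_diag mat_1_in_SL2]
    by (intro dual_invertible) (auto simp: mem_Times_iff)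
  have factor: "fst (?\<phi> (id, x)) = P ** ?h x ** mat 1" if "x \<in> SL2" for x
    using A_parameter_mult_id[OF \<psi> norm_diag mat_1_in_SL2 mat_1_in_SL2 that, of id]
    by (simp add: val P_def)
  have PD: "((\<lambda>x. fst (?\<phi> (id, x))) has_derivative (\<lambda>\<xi>. P ** D \<xi> ** mat 1)) (at (mat 1) within SL2)"
    by (rule has_derivative_transform[OF mat_1_in_SL2 factor
          bounded_linear.has_derivative[OF bounded_linear_mat_mult D]])
  obtain g where g: "invertible g"
    and gPD: "((\<lambda>x. fst (\<phi> (id, x))) has_derivative (\<lambda>\<xi>. conj_mat g (P ** D \<xi> ** mat 1)))
      (at (mat 1) within SL2)"
    by (rule has_derivative_L_equiv[OF eq closed[OF id_weil] PD])
  have "conj_mat g (P ** D (mat2 0 1 0 0) ** mat 1) = 0"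
  \<comment> \<open>\<open>\<phi>\<close> is known only as a conjugate of \<open>?\<phi>\<close>, so
    its values in the \<open>L\<close>-group come from those of \<open>?\<phi>\<close> by
    \<open>LG_conj_closed\<close>.\<close>
  proof (rule derivative_zero_if_param_orbit_zero[OF orbit gPD])
    fix w
    assume w: "w \<in> weil_group v"
    then have "?\<phi> (w, norm_diag v w) \<in> Gd \<times> weil_group v"
      using closed[OF w norm_diag[of w]] w by (simp add: mem_Times_iff)
    moreover obtain k where "k \<in> Gd"
      "\<phi> (w, norm_diag v w) = LG_conj v Gd a k (?\<phi> (w, norm_diag v w))"
      using eq w norm_diag unfolding L_equiv_def by blast
    ultimately show "\<phi> (w, norm_diag v w) \<in> Gd \<times> weil_group v"
      using LG_conj_closed by simp
  qed
  then have "P ** D (mat2 0 1 0 0) = 0"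
    using g by (simp add: conj_mat_eq_0_iff)
  then have "matrix_inv P ** P ** D (mat2 0 1 0 0) = 0"
    by (simp flip: matrix_mul_assoc)
  then have zero: "D (mat2 0 1 0 0) = 0"
    using P by (simp add: matrix_inv_mult)
  have "?h y = mat 1" if "y \<in> SL2" for y
  proof (rule SL2_hom_trivial_if_derivative_zero[OF _ A_parameter_one[OF \<psi>] D linear zero that])
    fix x y :: SL2_matrix
    assume "x \<in> SL2" "y \<in> SL2"
    then show "?h (x ** y) = ?h x ** ?h y"
      using A_parameter_mult_id[OF \<psi> mat_1_in_SL2 _ mat_1_in_SL2] by simp
  qed
  moreover have "snd (\<psi> (id, mat 1, y)) = id" if "y \<in> SL2" for y
    using A_parameter_closed[OF \<psi> id_weil mat_1_in_SL2 that] by auto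
  ultimately show ?thesis
    by (simp add: tempered_A_parameter_def prod_eq_iff)
qed

text \<open>Having the zero orbit depends only on the conjugacy class. The derivative of
  \<open>\<phi>\<^sub>1\<close> serves as the link: it vanishes on the nilpotent because its
  conjugate for \<open>\<phi>\<^sub>0\<close> does, and then so does its conjugate for
  \<open>\<phi>\<^sub>2\<close>.\<close>

lemma param_orbit_zero_if_L_equiv_zero_orbit:
  assumes \<phi>\<^sub>0: "zero_orbit_parameter v Gd a \<phi> \<phi>\<^sub>0"
    and \<phi>\<^sub>1: "L_parameter v Gd a \<phi>\<^sub>1"
    and eq: "L_equiv v Gd a \<phi>\<^sub>1 \<phi>\<^sub>0" "L_equiv v Gd a \<phi>\<^sub>1 \<phi>\<^sub>2"
  shows "param_orbit v Gd a \<phi>\<^sub>2 \<subseteq> {0}"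
proof -
  obtain D where D: "((\<lambda>x. fst (\<phi>\<^sub>1 (id, x))) has_derivative D) (at (mat 1) within SL2)"
    using L_parameter_derivative[OF \<phi>\<^sub>1] by blast
  note closed = L_parameter_closed[OF \<phi>\<^sub>1 id_weil]
  obtain g where g: "invertible g"
    and D0: "((\<lambda>x. fst (\<phi>\<^sub>0 (id, x))) has_derivative (\<lambda>\<xi>. conj_mat g (D \<xi>))) (at (mat 1) within SL2)"
    by (rule has_derivative_L_equiv[OF eq(1) closed D])
  obtain g' where
    D2: "((\<lambda>x. fst (\<phi>\<^sub>2 (id, x))) has_derivative (\<lambda>\<xi>. conj_mat g' (D \<xi>))) (at (mat 1) within SL2)"
    by (rule has_derivative_L_equiv[OF eq(2) closed D])
  have "L_parameter v Gd a \<phi>\<^sub>0" "param_orbit v Gd a \<phi>\<^sub>0 \<subseteq> {0}"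
    using \<phi>\<^sub>0 by (auto simp: zero_orbit_parameter_def orbit_def conj_mat_def)
  then have "conj_mat g (D (mat2 0 1 0 0)) = 0"
    using L_parameter_closed[OF _ _ norm_diag, of \<phi>\<^sub>0]
    by (intro derivative_zero_if_param_orbit_zero[OF _ D0]) (simp_all add: mem_Times_iff)
  then have "D (mat2 0 1 0 0) = 0"
    using g by (simp add: conj_mat_eq_0_iff)
  then show ?thesis
    by (intro param_orbit_subset_zero[OF D2]) (simp add: conj_mat_def)
qed

end

section \<open>From the closure ordering to temperedness\<close>

lemma L_group_if_L_group_data:
  assumes "nonarch_local_field v" "L_group_data v G Gd a"
  shows "L_group v Gd a"
proof -
  have "subgroup Gd GL"
    using assms(2) by (simp add: L_group_data_def connected_reductive_def linear_group_def)
  moreover have "\<And>w. w \<in> weil_group v \<Longrightarrow> a w \<in> iso (grp Gd) (grp Gd)"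
    and "\<And>w w' g. w \<in> weil_group v \<Longrightarrow> w' \<in> weil_group v \<Longrightarrow> g \<in> Gd \<Longrightarrow>
      a (w \<circ> w') g = a w (a w' g)"
    using assms(2) unfolding L_group_data_def by (elim conjE exE, simp)+
  ultimately show ?thesis
    using assms(1) by (intro L_group.intro)
qed

text \<open>Singletons are closed in a T1 space. With \<open>x = 0\<close> this is the closedness of
  the zero orbit in the Vogan variety.\<close>

lemma closure_of_subset_singleton:
  fixes x :: "'a::t1_space"
  assumes "A \<subseteq> {x}"
  shows "top_of_set S closure_of A \<subseteq> {x}"
  using assms closure_minimal[of "S \<inter> A" "{x}"] by (auto simp: closure_of_subtopology)

theorem theorem6p9:
  fixes v :: "'f::field_char_0 \<Rightarrow> real"
    and G B :: "('f alg_closure ^ 'n ^ 'n) set"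
    and Gd :: "(complex ^ 'm ^ 'm) set"
    and a :: "'f gal \<Rightarrow> complex ^ 'm ^ 'm \<Rightarrow> complex ^ 'm ^ 'm"
    and llc :: "('f, 'n) irrep set \<Rightarrow> ('f, 'm) L_param"
    and Pkt :: "('f, 'm) A_param \<Rightarrow> ('f, 'n) irrep set multiset"
    and \<psi> :: "('f, 'm) A_param"
  assumes local_field: "nonarch_local_field v"
    and reductive: "connected_reductive base G"
    and quasi_split: "quasi_split base G"
    and borel: "rational_borel base G B"
    and L_group: "L_group_data v G Gd a"
    and LLC: "local_langlands v G Gd a llc"
    and packets: "arthur_packets v G Gd a llc Pkt"
    and closure_ordering:
      "\<And>\<psi> \<pi>. A_parameter v Gd a \<psi> \<Longrightarrow> \<pi> \<in># Pkt \<psi> \<Longrightarrow> closure_ge v Gd a (llc \<pi>) (A_to_L v \<psi>)"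
    and aubert:
      "\<And>\<psi>. A_parameter v Gd a \<psi> \<Longrightarrow> Pkt (A_swap \<psi>) = image_mset (aubert_dual v G B) (Pkt \<psi>)"
    and generic_dual:
      "\<And>\<pi>. \<pi> \<in> Irr v (points G) \<Longrightarrow> generic v G \<pi> \<Longrightarrow> arthur_type v Gd a Pkt \<pi> \<Longrightarrow>
         \<exists>\<phi>\<^sub>0. zero_orbit_parameter v Gd a (llc \<pi>) \<phi>\<^sub>0 \<and>
              aubert_dual v G B \<pi> \<in> L_packet v G Gd a llc \<phi>\<^sub>0"
    and psi: "A_parameter v Gd a \<psi>"
    and contains_generic: "\<exists>\<pi>. \<pi> \<in># Pkt \<psi> \<and> generic v G \<pi>"
  shows "tempered_A_parameter \<psi>"
proof -
  interpret L_group v Gd a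
    using local_field L_group by (rule L_group_if_L_group_data)
  obtain \<pi> where \<pi>: "\<pi> \<in># Pkt \<psi>" "generic v G \<pi>"
    using contains_generic by blast
  then have "\<pi> \<in> Irr v (points G)" "arthur_type v Gd a Pkt \<pi>"
    using psi by (auto simp: generic_def arthur_type_def)
  then obtain \<phi>\<^sub>0 where \<phi>\<^sub>0: "zero_orbit_parameter v Gd a (llc \<pi>) \<phi>\<^sub>0"
    and dual: "aubert_dual v G B \<pi> \<in> L_packet v G Gd a llc \<phi>\<^sub>0"
    using generic_dual \<pi>(2) by blast
  let ?\<phi> = "llc (aubert_dual v G B \<pi>)"
  \<comment> \<open>\<open>aubert_dual\<close> is a \<open>THE\<close>; that it is an irreducible
    representation here, and hence has a parameter, is read off from its membership in an
    \<open>L\<close>-packet.\<close>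
  have \<phi>: "L_parameter v Gd a ?\<phi>" "L_equiv v Gd a ?\<phi> \<phi>\<^sub>0"
    using dual LLC by (auto simp: L_packet_def local_langlands_def)
  have "aubert_dual v G B \<pi> \<in># Pkt (A_swap \<psi>)"
    using \<pi>(1) by (simp add: aubert[OF psi])
  then have "closure_ge v Gd a ?\<phi> (A_to_L v (A_swap \<psi>))"
    using closure_ordering A_parameter_A_swap[OF psi] by blast
  then obtain \<phi>\<^sub>1 \<phi>\<^sub>2 where "L_equiv v Gd a ?\<phi> \<phi>\<^sub>1"
    and \<phi>\<^sub>2: "L_equiv v Gd a (A_to_L v (A_swap \<psi>)) \<phi>\<^sub>2"
    and sub: "param_orbit v Gd a \<phi>\<^sub>2 \<subseteq>
      top_of_set (vogan_variety v Gd a (infinitesimal_character v \<phi>\<^sub>1))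
        closure_of (param_orbit v Gd a \<phi>\<^sub>1)"
    unfolding closure_ge_def by blast
  \<comment> \<open>The representative \<open>\<phi>\<^sub>1\<close> chosen by the ordering may
    differ from \<open>\<phi>\<^sub>0\<close>, but both are conjugate to
    \<open>?\<phi>\<close>.\<close>
  then have "param_orbit v Gd a \<phi>\<^sub>1 \<subseteq> {0}"
    using param_orbit_zero_if_L_equiv_zero_orbit[OF \<phi>\<^sub>0 \<phi>] by blast
  then have "param_orbit v Gd a \<phi>\<^sub>2 \<subseteq> {0}"
    using sub closure_of_subset_singleton by blast
  then show ?thesis
    using tempered_if_param_orbit_zero[OF psi \<phi>\<^sub>2] by blast
qed

end
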